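(* Let $\mathcal D_s$ have index set $\mathcal S$, let $\bm\theta_{\mathcal S}^*$ be a finite optimizer of the (finite) leaf problem $\min_{\bm\theta\in\Theta}\mathcal L_{\mathcal S}(\bm\theta)$, let $\mathcal I^*$ index the constraints of $\Theta$ active at $\bm\theta_{\mathcal S}^*$, and suppose the active face at $\bm\theta_{\mathcal S}^*$ is locally stable (see context) and $\mathcal V_{\mathcal S}^*\ne\{\bm0\}$. Let $\bm Z$ have orthonormal columns spanning $\mathcal V_{\mathcal S}^*$ and write $\bm G(\bm\theta):=\nabla^2\mathcal L_{\mathcal S}(\bm\theta)$. On a sufficiently small convex neighborhood $\mathcal U$ of $\bm\theta_{\mathcal S}^*$ within this face on which $\Delta_{\mathcal S}\|\bm d_t\|_2\le1$ holds for the selected directions, define $$ \begin{aligned} m_{\mathcal S}&:=\inf_{\bm\theta\in\mathcal U}\lambda_{\min}\!\left(\bm Z^\top\bm G(\bm\theta)\bm Z\right),& L_{G,\mathcal S}&:=\sup_{\bm\theta,\bm\theta'\in\mathcal U,\ \bm\theta\ne\bm\theta'}\frac{\|\bm Z^\top[\bm G(\bm\theta)-\bm G(\bm\theta')]\bm Z\|_2}{\|\bm\theta-\bm\theta'\|_2},\\ M_{\pi,\mathcal S}&:=\max_{i\in\mathcal S}\sup_{\bm\theta\in\mathcal U}\|D\bm\pi_i(\bm\theta)\bm Z\|_2,& L_{\pi,\mathcal S}&:=\max_{i\in\mathcal S}\sup_{\bm\theta,\bm\theta'\in\mathcal U,\ \bm\theta\ne\bm\theta'}\frac{\|[D\bm\pi_i(\bm\theta)-D\bm\pi_i(\bm\theta')]\bm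 Z\|_2}{\|\bm\theta-\bm\theta'\|_2}, \end{aligned} $$ $$ C_{\mathcal S}:=\frac{L_{\pi,\mathcal S}}{2m_{\mathcal S}}+\frac{2M_{\pi,\mathcal S}L_{G,\mathcal S}}{m_{\mathcal S}^2},\qquad \pi_{\min,\mathcal S}^*:=\min_{i\in\mathcal S,\ j\in\{0\}\cup\mathcal J}\pi_{ij}(\bm\theta_{\mathcal S}^* ). $$ Then $m_{\mathcal S}>0$, and every constrained Newton checkpoint $\bm\theta_t\in\mathcal U$ satisfies, with $\nu_t^2:=\bm d_t^\top\bm G_t\bm d_t$, $$\max_{i\in\mathcal S}\|\bm q_i^t-\bm\pi_i(\bm\theta_{\mathcal S}^* )\|_2\le C_{\mathcal S}\nu_t^2.$$ Moreover, $$ 0\le H(\mathcal D_s)-\mathrm{LB}_t(\mathcal D_s)=\sum_{i\in\mathcal S}\mathrm{KL}\!\left(\bm q_i^t\,\middle\|\,\bm\pi_i(\bm\theta_{\mathcal S}^* )\right)\le\frac{|\mathcal S|\,C_{\mathcal S}^2}{\pi_{\min,\mathcal S}^*}\,\nu_t^4 . $$ Consequently, $\mathrm{LB}_t(\mathcal D_s)\to H(\mathcal D_s)$ as $\bm\theta_t\to\bm\theta_{\mathcal S}^*$ within $\mathcal U$.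
   Context: $\mathcal J$ is a finite nonempty set of products, $0$ is the outside option, $\mathcal F$ is a finite set of covariates. Data: $\mathcal D=\{(\bm x_i,\bm p_i,y_i)\}_{i\in\mathcal I}$, $\mathcal I$ finite, $\bm x_i\in\mathbb R^{|\mathcal F|}$, $\bm p_i\in\mathbb R_+^{|\mathcal J|}$, $y_i\in\{0\}\cup\mathcal J$. Parameters $\bm\theta=(\bm\alpha,\bm\beta,\bm\gamma)\in\mathbb R^{N_0}$, $N_0=2|\mathcal J|+|\mathcal F|$. With $\bm e_j$ the $j$th coordinate vector of $\mathbb R^{|\mathcal J|}$, $\bm a_{ij}=(\bm e_j,\bm x_i,-p_{ij}\bm e_j)\in\mathbb R^{N_0}$ for $j\in\mathcal J$ and $\bm a_{i0}=\bm0$; $\bm A_i$ is the matrix with rows $\bm a_{ij}^\top$, $j\in\{0\}\cup\mathcal J$. $\pi_{ij}(\bm\theta)=\exp(\bm a_{ij}^\top\bm\theta)/\sum_{l\in\{0\}\cup\mathcal J}\exp(\bm a_{il}^\top\bm\theta)$, $\bm\pi_i(\bm\theta)=(\pi_{ij}(\bm\theta))_{j\in\{0\}\cup\mathcal J}$, $D\bm\pi_i$ is its Jacobian, $\ell_i(\bm\theta)=-\log\pi_{i,y_i}(\bm\theta)$, $\mathcal L_{\mathcal S}(\bm\theta)=\sum_{i\in\mathcal S}\ell_i(\bm\theta)$. $\Theta=\{\bm\theta\in\mathbb R^{N_0}:\bm A_\Theta\bm\theta\le\bm b_\Theta\}$ is a nonempty closed polyhedron (whose constraints include $\gamma_j\ge\underline\gamma>0$).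 With penalty $\lambda\ge0$ and minimum leaf size $N_{\min}\geq 1$, the leaf cost is $H(\mathcal D_s)=\min_{\bm\theta\in\Theta}\{\mathcal L_{\mathcal S}(\bm\theta)+\lambda N_0\}$ if $|\mathcal D_s|\ge N_{\min}$, and $+\infty$ otherwise; here the leaf problem is finite, i.e. $|\mathcal D_s|\ge N_{\min}$. Constrained Newton. At each feasible iterate (checkpoint) $\bm\theta_t\in\Theta$, with $\bm g_t=\nabla\mathcal L_{\mathcal S}(\bm\theta_t)$, $\bm G_t=\nabla^2\mathcal L_{\mathcal S}(\bm\theta_t)$, the path selects a primal–dual solution $(\bm d_t,\bm\mu_t)$ of $\min_{\bm d}\{\bm g_t^\top\bm d+\tfrac12\bm d^\top\bm G_t\bm d:\bm A_\Theta(\bm\theta_t+\bm d)\le\bm b_\Theta\}$, i.e. $\bm A_\Theta(\bm\theta_t+\bm d_t)\le\bm b_\Theta$, $\bm\mu_t\ge\bm0$, $\bm g_t+\bm G_t\bm d_t+\bm A_\Theta^\top\bm\mu_t=\bm0$, $\bm\mu_t^\top(\bm b_\Theta-\bm A_\Theta(\bm\theta_t+\bm d_t))=0$. Set $\pi^t_{ij}=\pi_{ij}(\bm\theta_t)$, $\bar{\bm a}_i^t=\sum_j\pi_{ij}^t\bm a_{ij}$, $q_{ij}^t=\pi_{ij}^t[1+(\bm a_{ij}-\bar{\bm a}_i^t)^\top\bm d_t]$, $\mathcal H_{\mathcal S}(\bm q)=-\sum_{i\in\mathcal S}\sum_{j\in\{0\}\cup\mathcal J}q_{ij}\log q_{ij}$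 ($0\log0=0$), and $\mathrm{LB}_t(\mathcal D_s)=\lambda N_0+\mathcal H_{\mathcal S}(\bm q^t)-\bm b_\Theta^\top\bm\mu_t$. $\Delta_{\mathcal S}:=\max_{i\in\mathcal S}\max_{j,k\in\{0\}\cup\mathcal J}\|\bm a_{ij}-\bm a_{ik}\|_2$; the condition $\Delta_{\mathcal S}\|\bm d_t\|_2\le1$ implies $\bm q^t\ge\bm0$. Subspaces. $\bm A_{\Theta,\mathcal I^*}$ denotes the rows of $\bm A_\Theta$ indexed by $\mathcal I^*$. $\mathcal N_{\mathcal S}:=\bigcap_{i\in\mathcal S}\operatorname{Null}(\bm A_i)$, $\mathcal T_{\mathcal S}^*:=\operatorname{Null}(\bm A_{\Theta,\mathcal I^*})$, $\mathcal K_{\mathcal S}^*:=\mathcal T_{\mathcal S}^*\cap\mathcal N_{\mathcal S}$, $\mathcal V_{\mathcal S}^*:=\mathcal T_{\mathcal S}^*\cap(\mathcal K_{\mathcal S}^* )^\perp$. The active face is the set of $\bm\theta\in\Theta$ at which all constraints in $\mathcal I^*$ hold with equality. It is locally stable along the selected constrained Newton path if, whenever an iterate $\bm\theta_t$ on this face is sufficiently close to $\bm\theta_{\mathcal S}^*$, its selected solution satisfies $\bm A_{\Theta,\mathcal I^*}\bm d_t=\bm0$ and $\mu_{t,r}=0$ for all $r\notin\mathcal I^*$. $\mathrm{KL}(\bm q\|\bm\pi)=\sum_jq_j\log(q_j/\pi_j)$; $\|\cdot\|_2$ is the Euclidean norm for vectors and the spectral norm for matrices; $\lambda_{\min}$ is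 the smallest eigenvalue. "Sufficiently small" means: there is a neighborhood of $\bm\theta_{\mathcal S}^*$ in the face such that the conclusions hold for every such $\mathcal U$ contained in it. *)

theory Defs
  imports "HOL-Analysis.Analysis"
begin

section \<open>Parameter coordinates\<close>

text \<open>
  Products form a finite type \<open>'j\<close>; the alternatives \<open>{0} \<union> J\<close> form \<open>'j option\<close>, with \<open>None\<close>
  the outside option. Covariates form a finite, possibly empty, set \<open>F\<close>. The parameter space
  is \<open>real^'n\<close>, where \<open>lab\<close> identifies the coordinates \<open>'n\<close> with those of
  \<open>(\<alpha>, \<beta>, \<gamma>)\<close>; a finite type cannot be empty, so \<open>F\<close> is not itself taken to be a type.
\<close>

datatype ('j, 'f) coord = Alpha 'j | Beta 'f | Gamma 'j

definition coord_labelling :: "('n \<Rightarrow> ('j, 'f) coord) \<Rightarrow> 'f set \<Rightarrow> bool" where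
  "coord_labelling lab F \<longleftrightarrow> bij_betw lab UNIV (range Alpha \<union> Beta ` F \<union> range Gamma)"

lemma card_coord_labelling:
  fixes lab :: "'n::finite \<Rightarrow> ('j::finite, 'f) coord"
  assumes "coord_labelling lab F" and "finite F"
  shows "CARD('n) = 2 * CARD('j) + card F"
proof -
  have "CARD('n) = card (range Alpha \<union> Beta ` F \<union> range Gamma :: ('j, 'f) coord set)"
    using assms(1) unfolding coord_labelling_def by (rule bij_betw_same_card)
  also have "\<dots> = card (range Alpha :: ('j, 'f) coord set) + card (Beta ` F :: ('j, 'f) coord set)
      + card (range Gamma :: ('j, 'f) coord set)"
    using assms(2) by (subst card_Un_disjoint; auto)+
  also have "\<dots> = 2 * CARD('j) + card F"
    by (simp add: card_image inj_on_def)
  finally show ?thesis .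
qed

section \<open>Multinomial logit loss\<close>

text \<open>The vector \<open>a\<^sub>i\<^sub>j = (e\<^sub>j, x\<^sub>i, - p\<^sub>i\<^sub>j e\<^sub>j)\<close>, with \<open>a\<^sub>i\<^sub>0 = 0\<close>.\<close>

definition attr_vec ::
  "('n::finite \<Rightarrow> ('j::finite, 'f) coord) \<Rightarrow> ('i \<Rightarrow> 'f \<Rightarrow> real) \<Rightarrow> ('i \<Rightarrow> real^'j)
    \<Rightarrow> 'i \<Rightarrow> 'j option \<Rightarrow> real^'n" where
  "attr_vec lab x p i alt = (case alt of
     None \<Rightarrow> 0
   | Some j \<Rightarrow> (\<chi> n. case lab n of
        Alpha k \<Rightarrow> if k = j then 1 else 0
      | Beta f \<Rightarrow> x i f
      | Gamma k \<Rightarrow> if k = j then - (p i $ j) else 0))"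

definition attr_matrix ::
  "('i \<Rightarrow> 'j option \<Rightarrow> real^'n) \<Rightarrow> 'i \<Rightarrow> real^'n^('j::finite option)" where
  "attr_matrix a i = (\<chi> j. a i j)"

definition choice_prob ::
  "('i \<Rightarrow> 'j option \<Rightarrow> real^'n) \<Rightarrow> 'i \<Rightarrow> real^'n \<Rightarrow> real^('j::finite option)" where
  "choice_prob a i \<theta> = (\<chi> j. exp (a i j \<bullet> \<theta>) / (\<Sum>l\<in>UNIV. exp (a i l \<bullet> \<theta>)))"

definition loss ::
  "('i \<Rightarrow> 'j option \<Rightarrow> real^'n) \<Rightarrow> ('i \<Rightarrow> 'j::finite option) \<Rightarrow> 'i set \<Rightarrow> real^'n \<Rightarrow> real" where
  "loss a y S \<theta> = (\<Sum>i\<in>S. - ln (choice_prob a i \<theta> $ y i))"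

definition gradient :: "(real^'n \<Rightarrow> real) \<Rightarrow> real^'n \<Rightarrow> real^'n" where
  "gradient f \<theta> = (THE g. GDERIV f \<theta> :> g)"

definition hessian :: "(real^'n \<Rightarrow> real) \<Rightarrow> real^'n \<Rightarrow> real^'n^'n" where
  "hessian f \<theta> = jacobian (gradient f) (at \<theta>)"

section \<open>The leaf problem\<close>

text \<open>On \<open>real^'m\<close>, \<open>\<le>\<close> is the componentwise order.\<close>

definition polyhedron_of :: "real^'n^'m \<Rightarrow> real^'m \<Rightarrow> (real^'n) set" where
  "polyhedron_of A b = {\<theta>. A *v \<theta> \<le> b}"

text \<open>
  The infimum is a minimum as soon as the leaf problem has an optimizer. The number of
  parameters is \<open>CARD('n)\<close>, see \<open>card_coord_labelling\<close>.
\<close>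

definition leaf_cost ::
  "('i \<Rightarrow> 'j option \<Rightarrow> real^'n) \<Rightarrow> ('i \<Rightarrow> 'j::finite option) \<Rightarrow> (real^'n) set \<Rightarrow> real \<Rightarrow> nat
    \<Rightarrow> 'i set \<Rightarrow> ereal" where
  "leaf_cost a y \<Theta> pen Nmin S =
    (if Nmin \<le> card S
     then INF \<theta>\<in>\<Theta>. ereal (loss a y S \<theta> + pen * real CARD('n))
     else \<infinity>)"

definition active_set :: "real^'n^'m \<Rightarrow> real^'m \<Rightarrow> real^'n \<Rightarrow> 'm set" where
  "active_set A b \<theta> = {r. (A *v \<theta>) $ r = b $ r}"

definition active_face :: "real^'n^'m \<Rightarrow> real^'m \<Rightarrow> 'm set \<Rightarrow> (real^'n) set" where
  "active_face A b R = {\<theta> \<in> polyhedron_of A b. \<forall>r\<in>R. (A *v \<theta>) $ r = b $ r}"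

section \<open>Constrained Newton steps\<close>

definition newton_pair ::
  "real^'n^'m \<Rightarrow> real^'m \<Rightarrow> (real^'n \<Rightarrow> real) \<Rightarrow> real^'n \<Rightarrow> real^'n \<Rightarrow> real^'m \<Rightarrow> bool" where
  "newton_pair A b f \<theta> d \<mu> \<longleftrightarrow>
     A *v (\<theta> + d) \<le> b \<and> 0 \<le> \<mu> \<and>
     gradient f \<theta> + hessian f \<theta> *v d + transpose A *v \<mu> = 0 \<and>
     \<mu> \<bullet> (b - A *v (\<theta> + d)) = 0"

text \<open>Here \<open>\<theta>\<close>, \<open>d\<close>, \<open>\<mu>\<close> are the iterates and selected solutions, indexed by \<open>t \<in> T\<close>.\<close>

definition locally_stable ::
  "real^'n^'m \<Rightarrow> real^'m \<Rightarrow> real^'n \<Rightarrow> 't set \<Rightarrow> ('t \<Rightarrow> real^'n) \<Rightarrow> ('t \<Rightarrow> real^'n) \<Rightarrow> ('t \<Rightarrow> real^'m)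
    \<Rightarrow> bool" where
  "locally_stable A b \<theta>opt T \<theta> d \<mu> \<longleftrightarrow>
     (\<exists>\<epsilon>>0. \<forall>t\<in>T. \<theta> t \<in> active_face A b (active_set A b \<theta>opt) \<and> dist (\<theta> t) \<theta>opt < \<epsilon> \<longrightarrow>
        (\<forall>r\<in>active_set A b \<theta>opt. (A *v d t) $ r = 0) \<and>
        (\<forall>r. r \<notin> active_set A b \<theta>opt \<longrightarrow> \<mu> t $ r = 0))"

definition mean_attr :: "('i \<Rightarrow> 'j::finite option \<Rightarrow> real^'n) \<Rightarrow> 'i \<Rightarrow> real^'n \<Rightarrow> real^'n" where
  "mean_attr a i \<theta> = (\<Sum>j\<in>UNIV. choice_prob a i \<theta> $ j *\<^sub>R a i j)"

definition newton_prob ::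
  "('i \<Rightarrow> 'j option \<Rightarrow> real^'n) \<Rightarrow> real^'n \<Rightarrow> real^'n \<Rightarrow> 'i \<Rightarrow> real^('j::finite option)" where
  "newton_prob a \<theta> d i =
    (\<chi> j. choice_prob a i \<theta> $ j * (1 + (a i j - mean_attr a i \<theta>) \<bullet> d))"

text \<open>Since \<open>ln 0 = 0\<close>, the convention \<open>0 log 0 = 0\<close> is built in, also in \<open>kl_div\<close>.\<close>

definition entropy :: "'i set \<Rightarrow> ('i \<Rightarrow> real^('j::finite option)) \<Rightarrow> real" where
  "entropy S q = - (\<Sum>i\<in>S. \<Sum>j\<in>UNIV. q i $ j * ln (q i $ j))"

definition kl_div :: "real^'k \<Rightarrow> real^'k \<Rightarrow> real" where
  "kl_div q \<pi> = (\<Sum>j\<in>UNIV. q $ j * ln (q $ j / \<pi> $ j))"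

definition lower_bound ::
  "('i \<Rightarrow> 'j::finite option \<Rightarrow> real^'n) \<Rightarrow> real^'m \<Rightarrow> real \<Rightarrow> 'i set \<Rightarrow> real^'n \<Rightarrow> real^'n \<Rightarrow> real^'m
    \<Rightarrow> real" where
  "lower_bound a b pen S \<theta> d \<mu> =
    pen * real CARD('n) + entropy S (newton_prob a \<theta> d) - b \<bullet> \<mu>"

definition attr_diam :: "('i \<Rightarrow> 'j::finite option \<Rightarrow> real^'n) \<Rightarrow> 'i set \<Rightarrow> real" where
  "attr_diam a S = Max {norm (a i j - a i k) | i j k. i \<in> S}"

section \<open>Subspaces\<close>

definition choice_null :: "('i \<Rightarrow> 'j::finite option \<Rightarrow> real^'n) \<Rightarrow> 'i set \<Rightarrow> (real^'n) set" where
  "choice_null a S = (\<Inter>i\<in>S. {v. attr_matrix a i *v v = 0})"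

definition face_tangent :: "real^'n^'m \<Rightarrow> 'm set \<Rightarrow> (real^'n) set" where
  "face_tangent A R = {v. \<forall>r\<in>R. (A *v v) $ r = 0}"

definition ident_space ::
  "('i \<Rightarrow> 'j::finite option \<Rightarrow> real^'n) \<Rightarrow> 'i set \<Rightarrow> real^'n^'m \<Rightarrow> 'm set \<Rightarrow> (real^'n) set" where
  "ident_space a S A R =
    face_tangent A R \<inter> orthogonal_comp (face_tangent A R \<inter> choice_null a S)"

section \<open>Local constants\<close>

definition nhd_within :: "'a::topological_space set \<Rightarrow> 'a \<Rightarrow> 'a set \<Rightarrow> bool" where
  "nhd_within X z U \<longleftrightarrow> U \<subseteq> X \<and> (\<exists>W. openin (top_of_set X) W \<and> z \<in> W \<and> W \<subseteq> U)"

definition spec_norm :: "real^'n^'m \<Rightarrow> real" where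
  "spec_norm M = onorm (\<lambda>v. M *v v)"

definition lambda_min :: "real^'k^'k \<Rightarrow> real" where
  "lambda_min M = (LEAST c. \<exists>v. v \<noteq> 0 \<and> M *v v = c *\<^sub>R v)"

definition m_const :: "(real^'n \<Rightarrow> real^'n^'n) \<Rightarrow> real^'k^'n \<Rightarrow> (real^'n) set \<Rightarrow> real" where
  "m_const G Z U = (INF \<theta>\<in>U. lambda_min (transpose Z ** G \<theta> ** Z))"

definition LG_const :: "(real^'n \<Rightarrow> real^'n^'n) \<Rightarrow> real^'k^'n \<Rightarrow> (real^'n) set \<Rightarrow> real" where
  "LG_const G Z U =
    Sup {spec_norm (transpose Z ** (G \<theta> - G \<theta>') ** Z) / norm (\<theta> - \<theta>') | \<theta> \<theta>'.
         \<theta> \<in> U \<and> \<theta>' \<in> U \<and> \<theta> \<noteq> \<theta>'}"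

definition choice_jac ::
  "('i \<Rightarrow> 'j option \<Rightarrow> real^'n) \<Rightarrow> 'i \<Rightarrow> real^'n \<Rightarrow> real^'n^('j::finite option)" where
  "choice_jac a i \<theta> = jacobian (choice_prob a i) (at \<theta>)"

definition Mpi_const ::
  "('i \<Rightarrow> 'j::finite option \<Rightarrow> real^'n) \<Rightarrow> 'i set \<Rightarrow> real^'k^'n \<Rightarrow> (real^'n) set \<Rightarrow> real" where
  "Mpi_const a S Z U = (MAX i\<in>S. SUP \<theta>\<in>U. spec_norm (choice_jac a i \<theta> ** Z))"

definition Lpi_const ::
  "('i \<Rightarrow> 'j::finite option \<Rightarrow> real^'n) \<Rightarrow> 'i set \<Rightarrow> real^'k^'n \<Rightarrow> (real^'n) set \<Rightarrow> real" where
  "Lpi_const a S Z U =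
    (MAX i\<in>S. Sup {spec_norm ((choice_jac a i \<theta> - choice_jac a i \<theta>') ** Z) / norm (\<theta> - \<theta>') | \<theta> \<theta>'.
                   \<theta> \<in> U \<and> \<theta>' \<in> U \<and> \<theta> \<noteq> \<theta>'})"

definition pi_min :: "('i \<Rightarrow> 'j::finite option \<Rightarrow> real^'n) \<Rightarrow> 'i set \<Rightarrow> real^'n \<Rightarrow> real" where
  "pi_min a S \<theta> = Min {choice_prob a i \<theta> $ j | i j. i \<in> S}"

end

theory Submission
  imports Defs
begin

text \<open>
  Multinomial logit probabilities are an exponential family, so a Newton model of the loss is the
  linearisation of the probabilities: the vector \<open>q\<^sub>i\<close> is \<open>\<pi>\<^sub>i(\<theta>) + D\<pi>\<^sub>i(\<theta>) d\<close>, and the mean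
  attribute under \<open>q\<close> is, summed over the sample, the model gradient plus the sum of the observed
  attributes. The stationarity condition of the Newton subproblem therefore says that the relative
  entropies of \<open>q\<^sub>i\<close> from \<open>\<pi>\<^sub>i(\<theta>\<^sup>*)\<close> sum exactly to the gap between the leaf value and the bound,
  as soon as the multipliers live on the constraints that are active at \<open>\<theta>\<^sup>*\<close>
  (\<open>newton_pair_gap_eq_kl_div\<close>). Relative entropy is nonnegative and at most the chi-square
  distance (\<open>kl_div_le_chi_square\<close>), so everything reduces to the estimate
  \<open>\<parallel>q\<^sub>i - \<pi>\<^sub>i(\<theta>\<^sup>*)\<parallel> \<le> C \<nu>\<^sup>2\<close>, which is \<open>newton_prob_error\<close>.

  For that estimate put \<open>w = \<theta>\<^sup>* - \<theta>\<close>. Both \<open>w\<close> and \<open>d\<close> are tangent to the face, and a tangent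
  vector splits into a part that leaves every probability of the sample unchanged and a part
  \<open>Z u\<close>; write \<open>u\<close> and \<open>u'\<close> for the coordinates of \<open>w\<close> and \<open>d\<close> and \<open>\<delta> = \<parallel>u\<parallel>\<close>. The
  expansions are taken from \<open>\<theta>\<close> towards \<open>\<theta>\<^sup>*\<close>, since the segment between these two points stays
  in the convex set \<open>U\<close>, whereas \<open>\<theta> + d\<close> may lie outside of it. Taylor's formula gives
  remainders \<open>L\<^sub>\<pi> \<delta>\<^sup>2 / 2\<close> for the probabilities and \<open>L\<^sub>G \<delta>\<^sup>2 / 2\<close> for the reduced gradient. The
  reduced gradient vanishes at \<open>\<theta>\<^sup>*\<close> and its linearisation at \<open>\<theta>\<close> vanishes at \<open>\<theta> + d\<close>, so
  \<open>\<parallel>u' - u\<parallel> \<le> L\<^sub>G \<delta>\<^sup>2 / (2 m)\<close>, and hence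
  \<open>\<parallel>q\<^sub>i - \<pi>\<^sub>i(\<theta>\<^sup>*)\<parallel> \<le> (L\<^sub>\<pi> / 2 + M L\<^sub>G / (2 m)) \<delta>\<^sup>2\<close>. Finally \<open>\<nu>\<^sup>2 \<ge> m \<parallel>u'\<parallel>\<^sup>2\<close>, and replacing
  \<open>\<delta>\<close> by \<open>\<parallel>u'\<parallel>\<close> costs a factor \<open>1 + O(\<delta>)\<close>. The summand \<open>2 M L\<^sub>G / m\<^sup>2\<close> of \<open>C\<close> is four times as
  large as needed, and this surplus pays for that factor, in both summands, as soon as
  \<open>L\<^sub>G \<delta> \<le> m / 2\<close> and \<open>L\<^sub>\<pi> \<delta> \<le> M\<close> (\<open>newton_step_arithmetic\<close>). The neighbourhood is chosen to
  force these two inequalities: the Lipschitz constants are bounded globally, \<open>m\<close> is bounded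
  below near \<open>\<theta>\<^sup>*\<close>, and \<open>M\<close> is bounded below because the identified directions are nontrivial and
  so move some probability (\<open>choice_jac_nonzero\<close>).

  The constants \<open>L\<^sub>\<pi>\<close> and \<open>L\<^sub>G\<close> compare with the full distance in \<open>U\<close>, which may be much larger
  than \<open>\<delta>\<close>. The Taylor bound with \<open>\<delta>\<close> alone, \<open>quadratic_remainder_modulo_invariant\<close>, uses them
  only for infinitesimal displacements along \<open>Z u\<close>.
\<close>

section \<open>Derivatives of the choice probabilities and of the loss\<close>

text \<open>Lets a derivative be read off from a formula for it, without computing matrix entries.\<close>
lemma jacobian_mult:
  fixes f :: "real^'n \<Rightarrow> real^'m"
  assumes "(f has_derivative f') (at x)"
  shows "jacobian f (at x) *v h = f' h"
proof -
  have "(f has_derivative (\<lambda>h. jacobian f (at x) *v h)) (at x)"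
    using assms by (subst jacobian_works[symmetric]) (auto simp: differentiable_def)
  then have "(\<lambda>h. jacobian f (at x) *v h) = f'"
    using assms by (rule has_derivative_unique)
  then show ?thesis by meson
qed

lemma choice_prob_nth:
  "choice_prob a i \<theta> $ j = exp (a i j \<bullet> \<theta>) / (\<Sum>l\<in>UNIV. exp (a i l \<bullet> \<theta>))"
  by (simp add: choice_prob_def)

lemma sum_exp_pos: "0 < (\<Sum>l\<in>UNIV. exp (a i (l::'j::finite option) \<bullet> \<theta>))"
  by (rule sum_pos) auto

lemma choice_prob_pos: "0 < choice_prob a i \<theta> $ j"
  unfolding choice_prob_nth by (simp add: sum_exp_pos)

lemma sum_choice_prob: "(\<Sum>j\<in>UNIV. choice_prob a i \<theta> $ j) = 1"
  unfolding choice_prob_nth sum_divide_distrib[symmetric]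
  using sum_exp_pos[of a i \<theta>] by simp

lemma choice_prob_le_1: "choice_prob a i \<theta> $ j \<le> 1"
  using sum_nonneg_leq_bound[of UNIV "\<lambda>j. choice_prob a i \<theta> $ j" 1 j]
  by (simp add: sum_choice_prob less_imp_le[OF choice_prob_pos])

lemma ln_choice_prob:
  "ln (choice_prob a i \<theta> $ j) = a i j \<bullet> \<theta> - ln (\<Sum>l\<in>UNIV. exp (a i l \<bullet> \<theta>))"
  unfolding choice_prob_nth using sum_exp_pos[of a i \<theta>] by (simp add: ln_div)

lemma inner_mean_attr:
  "mean_attr a i \<theta> \<bullet> h = (\<Sum>j\<in>UNIV. choice_prob a i \<theta> $ j * (a i j \<bullet> h))"
  by (simp add: mean_attr_def inner_sum_left)

lemma has_derivative_lse:
  "((\<lambda>\<theta>. ln (\<Sum>l\<in>UNIV. exp (a i (l::'j::finite option) \<bullet> \<theta>))) has_derivative (\<lambda>h. mean_attr a i \<theta> \<bullet> h)) (at \<theta>)"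
proof -
  let ?E = "\<lambda>\<theta>. \<Sum>l\<in>UNIV. exp (a i (l::'j option) \<bullet> \<theta>)"
  have "(?E has_derivative (\<lambda>h. \<Sum>l\<in>UNIV. exp (a i l \<bullet> \<theta>) * (a i l \<bullet> h))) (at \<theta>)"
    by (auto intro!: derivative_eq_intros simp: mult_ac)
  then have "((\<lambda>\<theta>. ln (?E \<theta>)) has_derivative
     (\<lambda>h. (\<Sum>l\<in>UNIV. exp (a i l \<bullet> \<theta>) * (a i l \<bullet> h)) * inverse (?E \<theta>))) (at \<theta>)"
    using sum_exp_pos[of a i \<theta>] by (rule has_derivative_ln[rotated])
  moreover have "(\<lambda>h. (\<Sum>l\<in>UNIV. exp (a i l \<bullet> \<theta>) * (a i l \<bullet> h)) * inverse (?E \<theta>))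
     = (\<lambda>h. mean_attr a i \<theta> \<bullet> h)"
    unfolding inner_mean_attr choice_prob_nth sum_distrib_right
    by (intro ext sum.cong) (auto simp: divide_inverse)
  ultimately show ?thesis by simp
qed

lemma choice_prob_exp:
  "choice_prob a i \<theta> $ j = exp (a i j \<bullet> \<theta> - ln (\<Sum>l\<in>UNIV. exp (a i l \<bullet> \<theta>)))"
  using ln_choice_prob[of a i \<theta> j] choice_prob_pos[of a i \<theta> j] by (metis exp_ln)

lemma has_derivative_choice_prob_nth:
  "((\<lambda>\<theta>. choice_prob a i \<theta> $ j) has_derivative
     (\<lambda>h. choice_prob a i \<theta> $ j * ((a i j - mean_attr a i \<theta>) \<bullet> h))) (at \<theta>)"
proof -
  let ?z = "\<lambda>\<theta>. a i j \<bullet> \<theta> - ln (\<Sum>l\<in>UNIV. exp (a i l \<bullet> \<theta>))"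
  have "(?z has_derivative (\<lambda>h. (a i j - mean_attr a i \<theta>) \<bullet> h)) (at \<theta>)"
    unfolding inner_diff_left
    by (intro has_derivative_diff has_derivative_lse has_derivative_inner_right has_derivative_ident)
  then have "((\<lambda>\<theta>. exp (?z \<theta>)) has_derivative
      (\<lambda>h. exp (?z \<theta>) * ((a i j - mean_attr a i \<theta>) \<bullet> h))) (at \<theta>)"
    by (rule has_derivative_exp[THEN has_derivative_eq_rhs]) (simp add: mult.commute)
  then show ?thesis
    unfolding choice_prob_exp .
qed

lemma has_derivative_choice_prob_explicit:
  "(choice_prob a i has_derivative
     (\<lambda>h. \<chi> j. choice_prob a i \<theta> $ j * ((a i j - mean_attr a i \<theta>) \<bullet> h))) (at \<theta>)"
  by (subst has_derivative_componentwise_within)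
     (auto simp: Basis_vec_def inner_axis has_derivative_choice_prob_nth)

lemma choice_jac_mult:
  "choice_jac a i \<theta> *v h = (\<chi> j. choice_prob a i \<theta> $ j * ((a i j - mean_attr a i \<theta>) \<bullet> h))"
  unfolding choice_jac_def
  by (rule jacobian_mult[OF has_derivative_choice_prob_explicit])

lemma has_derivative_choice_prob:
  "(choice_prob a i has_derivative (\<lambda>h. choice_jac a i \<theta> *v h)) (at \<theta>)"
  unfolding choice_jac_mult by (rule has_derivative_choice_prob_explicit)

text \<open>Each Newton probability vector is the first-order model of the choice probabilities at the checkpoint.\<close>
lemma newton_prob_eq:
  "newton_prob a \<theta> d i = choice_prob a i \<theta> + choice_jac a i \<theta> *v d"
  by (simp add: newton_prob_def choice_jac_mult vec_eq_iff algebra_simps)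

lemma loss_eq:
  "loss a y S \<theta> = (\<Sum>i\<in>S. ln (\<Sum>l\<in>UNIV. exp (a i l \<bullet> \<theta>)) - a i (y i) \<bullet> \<theta>)"
  by (simp add: loss_def ln_choice_prob)

lemma has_derivative_loss:
  "(loss a y S has_derivative (\<lambda>h. (\<Sum>i\<in>S. mean_attr a i \<theta> - a i (y i)) \<bullet> h)) (at \<theta>)"
proof -
  have "((\<lambda>\<theta>. \<Sum>i\<in>S. ln (\<Sum>l\<in>UNIV. exp (a i l \<bullet> \<theta>)) - a i (y i) \<bullet> \<theta>) has_derivative
      (\<lambda>h. (\<Sum>i\<in>S. mean_attr a i \<theta> - a i (y i)) \<bullet> h)) (at \<theta>)"
    unfolding inner_sum_left inner_diff_left
    by (intro has_derivative_sum has_derivative_diff has_derivative_lse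
        has_derivative_inner_right has_derivative_ident)
  then show ?thesis
    unfolding loss_eq[symmetric] .
qed

lemma gradient_loss:
  "gradient (loss a y S) \<theta> = (\<Sum>i\<in>S. mean_attr a i \<theta> - a i (y i))"
  unfolding gradient_def
proof (rule the_equality)
  show *: "GDERIV (loss a y S) \<theta> :> (\<Sum>i\<in>S. mean_attr a i \<theta> - a i (y i))"
    unfolding gderiv_def
    by (rule has_derivative_eq_rhs[OF has_derivative_loss]) (rule ext, rule inner_commute)
  show "g = (\<Sum>i\<in>S. mean_attr a i \<theta> - a i (y i))" if "GDERIV (loss a y S) \<theta> :> g" for g
    using fun_cong[OF has_derivative_unique[OF that[unfolded gderiv_def] *[unfolded gderiv_def]]]
    by (subst vector_eq_ldot[symmetric]) blast
qed

lemma has_derivative_mean_attr: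
  "(mean_attr a i has_derivative
     (\<lambda>h. \<Sum>j\<in>UNIV. (choice_prob a i \<theta> $ j * ((a i j - mean_attr a i \<theta>) \<bullet> h)) *\<^sub>R a i j)) (at \<theta>)"
proof -
  have "((\<lambda>\<theta>. \<Sum>j\<in>UNIV. choice_prob a i \<theta> $ j *\<^sub>R a i j) has_derivative
     (\<lambda>h. \<Sum>j\<in>UNIV. (choice_prob a i \<theta> $ j * ((a i j - mean_attr a i \<theta>) \<bullet> h)) *\<^sub>R a i j)) (at \<theta>)"
    by (intro has_derivative_sum has_derivative_scaleR_left has_derivative_choice_prob_nth)
  then show ?thesis
    unfolding mean_attr_def[symmetric] .
qed

lemma has_derivative_gradient_explicit:
  "(gradient (loss a y S) has_derivative
     (\<lambda>h. \<Sum>i\<in>S. \<Sum>j\<in>UNIV. (choice_prob a i \<theta> $ j * ((a i j - mean_attr a i \<theta>) \<bullet> h)) *\<^sub>R a i j)) (at \<theta>)"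
proof -
  have "((\<lambda>\<theta>. mean_attr a i \<theta> - a i (y i)) has_derivative
     (\<lambda>h. \<Sum>j\<in>UNIV. (choice_prob a i \<theta> $ j * ((a i j - mean_attr a i \<theta>) \<bullet> h)) *\<^sub>R a i j)) (at \<theta>)" for i
    using has_derivative_diff[OF has_derivative_mean_attr[of a i \<theta>] has_derivative_const[of "a i (y i)"]]
    by (simp only: diff_zero)
  then have "((\<lambda>\<theta>. \<Sum>i\<in>S. mean_attr a i \<theta> - a i (y i)) has_derivative
     (\<lambda>h. \<Sum>i\<in>S. \<Sum>j\<in>UNIV. (choice_prob a i \<theta> $ j * ((a i j - mean_attr a i \<theta>) \<bullet> h)) *\<^sub>R a i j)) (at \<theta>)"
    by (intro has_derivative_sum)
  then show ?thesis
    unfolding gradient_loss[symmetric] .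
qed

lemma hessian_loss_mult:
  "hessian (loss a y S) \<theta> *v h =
    (\<Sum>i\<in>S. \<Sum>j\<in>UNIV. (choice_prob a i \<theta> $ j * ((a i j - mean_attr a i \<theta>) \<bullet> h)) *\<^sub>R a i j)"
  unfolding hessian_def
  by (rule jacobian_mult[OF has_derivative_gradient_explicit])

lemma has_derivative_gradient:
  "(gradient (loss a y S) has_derivative (\<lambda>h. hessian (loss a y S) \<theta> *v h)) (at \<theta>)"
  unfolding hessian_loss_mult by (rule has_derivative_gradient_explicit)

text \<open>The covariance structure behind the Hessian: deviations from the mean attribute average to zero.\<close>
lemma sum_choice_prob_centred:
  "(\<Sum>j\<in>UNIV. choice_prob a i \<theta> $ j * ((a i j - mean_attr a i \<theta>) \<bullet> h)) = 0"
proof -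
  have "(\<Sum>j\<in>UNIV. choice_prob a i \<theta> $ j * ((a i j - mean_attr a i \<theta>) \<bullet> h)) =
    (\<Sum>j\<in>UNIV. choice_prob a i \<theta> $ j * (a i j \<bullet> h))
      - (\<Sum>j\<in>UNIV. choice_prob a i \<theta> $ j) * (mean_attr a i \<theta> \<bullet> h)"
    unfolding inner_diff_left right_diff_distrib sum_subtractf sum_distrib_right ..
  then show ?thesis
    unfolding sum_choice_prob inner_mean_attr by simp
qed

text \<open>
  The Hessian is the sum over the sample of the covariances of the attributes. One of the two
  centrings is free because centred attributes average to zero, which turns the asymmetric formula of
  \<open>hessian_loss_mult\<close> into a visibly symmetric, positive semidefinite one.
\<close>
lemma hessian_loss_form:
  "h \<bullet> (hessian (loss a y S) \<theta> *v h') =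
    (\<Sum>i\<in>S. \<Sum>j\<in>UNIV. choice_prob a i \<theta> $ j *
       ((a i j - mean_attr a i \<theta>) \<bullet> h) * ((a i j - mean_attr a i \<theta>) \<bullet> h'))"
proof -
  have "(\<Sum>j\<in>UNIV. choice_prob a i \<theta> $ j * ((a i j - mean_attr a i \<theta>) \<bullet> h') * (a i j \<bullet> h)) =
     (\<Sum>j\<in>UNIV. choice_prob a i \<theta> $ j *
       ((a i j - mean_attr a i \<theta>) \<bullet> h) * ((a i j - mean_attr a i \<theta>) \<bullet> h'))" for i
  proof -
    define m where "m = mean_attr a i \<theta>"
    have "(\<Sum>j\<in>UNIV. choice_prob a i \<theta> $ j * ((a i j - m) \<bullet> h) * ((a i j - m) \<bullet> h')) =
      (\<Sum>j\<in>UNIV. choice_prob a i \<theta> $ j * ((a i j - m) \<bullet> h') * (a i j \<bullet> h)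
        - choice_prob a i \<theta> $ j * ((a i j - m) \<bullet> h') * (m \<bullet> h))"
    proof (rule sum.cong)
      fix j
      have "(a i j - m) \<bullet> h = a i j \<bullet> h - m \<bullet> h"
        by (rule inner_diff_left)
      then show "choice_prob a i \<theta> $ j * ((a i j - m) \<bullet> h) * ((a i j - m) \<bullet> h') =
         choice_prob a i \<theta> $ j * ((a i j - m) \<bullet> h') * (a i j \<bullet> h)
        - choice_prob a i \<theta> $ j * ((a i j - m) \<bullet> h') * (m \<bullet> h)"
        by (simp only: right_diff_distrib mult_ac)
    qed simp
    also have "\<dots> = (\<Sum>j\<in>UNIV. choice_prob a i \<theta> $ j * ((a i j - m) \<bullet> h') * (a i j \<bullet> h))
      - (\<Sum>j\<in>UNIV. choice_prob a i \<theta> $ j * ((a i j - m) \<bullet> h')) * (m \<bullet> h)"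
      unfolding sum_subtractf sum_distrib_right ..
    finally show ?thesis
      unfolding m_def sum_choice_prob_centred by simp
  qed
  moreover have "h \<bullet> (hessian (loss a y S) \<theta> *v h') = (\<Sum>i\<in>S. \<Sum>j\<in>UNIV.
      choice_prob a i \<theta> $ j * ((a i j - mean_attr a i \<theta>) \<bullet> h') * (a i j \<bullet> h))"
    unfolding hessian_loss_mult inner_sum_right inner_scaleR_right
    by (intro sum.cong refl arg_cong2[of _ _ _ _ "(*)"] inner_commute)
  ultimately show ?thesis
    by simp
qed

section \<open>A Taylor bound modulo invariant directions\<close>

text \<open>
  A local Lipschitz estimate on \<open>(0, 1]\<close> chains along the interval. The left end point may fail to
  have a local estimate with the constant \<open>c\<close>; there any Lipschitz constant \<open>c'\<close> suffices, since
  its contribution vanishes in the limit.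
\<close>
lemma lipschitz_from_local:
  fixes f :: "real \<Rightarrow> 'a::real_normed_vector"
  assumes "0 \<le> c"
    and local: "\<And>s. 0 < s \<Longrightarrow> s \<le> 1 \<Longrightarrow>
      \<exists>\<delta>>0. \<forall>s'\<in>{0..1}. \<bar>s' - s\<bar> < \<delta> \<longrightarrow> norm (f s' - f s) \<le> c * \<bar>s' - s\<bar>"
    and global: "\<And>s s'. s \<in> {0..1} \<Longrightarrow> s' \<in> {0..1} \<Longrightarrow> norm (f s' - f s) \<le> c' * \<bar>s' - s\<bar>"
    and s: "0 \<le> s" "s \<le> 1"
  shows "norm (f s - f 0) \<le> c * s"
proof -
  have inner: "norm (f v - f u) \<le> c * (v - u)" if uv: "0 < u" "u \<le> v" "v \<le> 1" for u v
  proof -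
    have "u \<le> v \<Longrightarrow> 0 < u \<longrightarrow> v \<le> 1 \<longrightarrow> norm (f v - f u) \<le> c * (v - u)"
    proof (induction rule: Bolzano)
      case (trans p q r)
      have "norm (f r - f p) \<le> norm (f q - f p) + norm (f r - f q)"
        by (metis add.commute diff_add_cancel add_diff_eq norm_triangle_ineq)
      with trans show ?case
        by (auto simp: algebra_simps)
    next
      case (local z)
      then have z: "0 < z" "z \<le> 1"
        using uv by auto
      obtain \<delta> where \<delta>: "\<delta> > 0"
        "\<And>s'. s' \<in> {0..1} \<Longrightarrow> \<bar>s' - z\<bar> < \<delta> \<Longrightarrow> norm (f s' - f z) \<le> c * \<bar>s' - z\<bar>"
        using assms(2)[OF z] by auto
      show ?case
      proof (intro exI conjI allI impI)
        fix p q assume pq: "p \<le> z \<and> z \<le> q \<and> q - p < \<delta>" "0 < p" "q \<le> 1"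
        have "norm (f q - f p) \<le> norm (f q - f z) + norm (f p - f z)"
          using norm_triangle_ineq4[of "f q - f z" "f p - f z"] by simp
        also have "\<dots> \<le> c * \<bar>q - z\<bar> + c * \<bar>p - z\<bar>"
          using pq by (intro add_mono \<delta>) auto
        also have "\<dots> = c * (q - p)"
          using pq by (auto simp: algebra_simps)
        finally show "norm (f q - f p) \<le> c * (q - p)" .
      qed (rule \<delta>)
    qed
    then show ?thesis using uv by auto
  qed
  show ?thesis
  proof (cases "s = 0")
    case False
    then have "s > 0" using s by simp
    \<comment> \<open>Only the step from \<open>0\<close> to a small \<open>u\<close> uses \<open>c'\<close>, and then \<open>u\<close> tends to \<open>0\<close>.\<close>
    have lim: "((\<lambda>u. c * (s - u) + c' * \<bar>0 - u\<bar>) \<longlongrightarrow> c * (s - 0) + c' * \<bar>0 - 0\<bar>) (at_right 0)"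
      by (intro tendsto_intros)
    have "eventually (\<lambda>u. norm (f s - f 0) \<le> c * (s - u) + c' * \<bar>0 - u\<bar>) (at_right 0)"
      using eventually_at_right_less eventually_at_right_real[OF \<open>s > 0\<close>]
    proof eventually_elim
      case (elim u)
      have "norm (f s - f 0) \<le> norm (f s - f u) + norm (f u - f 0)"
        using norm_triangle_ineq[of "f s - f u" "f u - f 0"] by simp
      also have "\<dots> \<le> c * (s - u) + c' * \<bar>0 - u\<bar>"
        using elim s inner[of u s] global[of 0 u] by (intro add_mono) auto
      finally show ?case .
    qed
    from tendsto_lowerbound[OF lim this] show ?thesis by simp
  qed simp
qed

text \<open>
  If the derivative of \<open>\<Phi>\<close> is invariant under translations along \<open>\<kappa>\<close> and annihilates \<open>\<kappa>\<close>, the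
  Taylor remainder for a displacement \<open>\<kappa> + v\<close> should depend on \<open>v\<close> only. But \<open>\<theta>0 + v\<close> need not
  lie in \<open>U\<close>, so the Lipschitz hypothesis does not compare the derivatives at \<open>\<theta>0\<close> and
  \<open>\<theta>0 + v\<close>. Since \<open>\<theta>1\<close> is interior to \<open>U\<close> in direction \<open>v\<close> and \<open>U\<close> is convex, every point
  of the segment other than \<open>\<theta>0\<close> is interior in direction \<open>v\<close> as well. There the segment can be
  followed infinitesimally along \<open>v\<close> instead of \<open>\<kappa> + v\<close>, with the right constant.
\<close>
lemma quadratic_remainder_modulo_invariant:
  fixes \<Phi> :: "'a::real_normed_vector \<Rightarrow> 'b::real_normed_vector"
  assumes deriv: "\<And>z. (\<Phi> has_derivative \<Phi>' z) (at z)"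
    and "convex U" and U0: "\<theta>0 \<in> U" and U1: "\<theta>1 \<in> U"
    and w: "\<theta>1 - \<theta>0 = \<kappa> + v"
    and inv: "\<And>z s. \<Phi>' (z + s *\<^sub>R \<kappa>) = \<Phi>' z" and kill: "\<And>z. \<Phi>' z \<kappa> = 0"
    and near: "r > 0" "\<And>c. \<bar>c\<bar> < r \<Longrightarrow> \<theta>1 + c *\<^sub>R v \<in> U"
    and lip: "\<And>z z'. z \<in> U \<Longrightarrow> z' \<in> U \<Longrightarrow> norm (\<Phi>' z v - \<Phi>' z' v) \<le> K * norm (z - z') * norm v"
    and "0 \<le> K"
  shows "norm (\<Phi> \<theta>1 - \<Phi> \<theta>0 - \<Phi>' \<theta>0 (\<theta>1 - \<theta>0)) \<le> K / 2 * (norm v)\<^sup>2"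
proof -
  define w where "w = \<theta>1 - \<theta>0"
  define \<gamma> where "\<gamma> s = \<theta>0 + s *\<^sub>R w" for s :: real
  define \<psi> where "\<psi> s = \<Phi>' (\<gamma> s) v" for s
  define c where "c = K * (norm v)\<^sup>2"
  have lin: "linear (\<Phi>' z)" for z
    using deriv[of z] by (rule has_derivative_linear)
  have w_eq: "w = \<kappa> + v"
    using w by (simp add: w_def)
  have \<psi>_w: "\<Phi>' (\<gamma> s) w = \<psi> s" for s
    by (simp add: w_eq linear_add[OF lin] kill \<psi>_def)
  have \<gamma>_U: "\<gamma> s \<in> U" if "s \<in> {0..1}" for s
  proof -
    have "\<gamma> s = (1 - s) *\<^sub>R \<theta>0 + s *\<^sub>R \<theta>1"
      by (simp add: \<gamma>_def w_def algebra_simps)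
    then show ?thesis
      using that \<open>convex U\<close> U0 U1 by (auto intro!: convexD)
  qed
  have local: "\<exists>\<delta>>0. \<forall>s'\<in>{0..1}. \<bar>s' - s\<bar> < \<delta> \<longrightarrow> norm (\<psi> s' - \<psi> s) \<le> c * \<bar>s' - s\<bar>"
    if s: "0 < s" "s \<le> 1" for s
  proof (intro exI conjI ballI impI)
    show "s * r > 0" using s near by simp
    fix s' assume s': "s' \<in> {0..1}" "\<bar>s' - s\<bar> < s * r"
    define z where "z = \<gamma> s + (s' - s) *\<^sub>R v"
    have "s *\<^sub>R (\<theta>1 + ((s' - s) / s) *\<^sub>R v) = s *\<^sub>R \<theta>1 + (s' - s) *\<^sub>R v"
      using s by (simp add: scaleR_add_right)
    then have "z = (1 - s) *\<^sub>R \<theta>0 + s *\<^sub>R (\<theta>1 + ((s' - s) / s) *\<^sub>R v)"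
      by (simp only:) (simp add: z_def \<gamma>_def w_def algebra_simps)
    moreover have "\<bar>(s' - s) / s\<bar> < r"
      using s s' by (simp add: divide_less_eq mult.commute)
    ultimately have zU: "z \<in> U"
      using s \<open>convex U\<close> U0 near(2)[of "(s' - s) / s"] by (auto intro!: convexD)
    \<comment> \<open>The detour point \<open>z\<close> differs from \<open>\<gamma> s'\<close> by an invariant displacement.\<close>
    have "\<gamma> s' = z + (s' - s) *\<^sub>R \<kappa>"
      by (simp add: z_def \<gamma>_def w_eq algebra_simps)
    then have "norm (\<psi> s' - \<psi> s) = norm (\<Phi>' z v - \<Phi>' (\<gamma> s) v)"
      by (simp add: \<psi>_def inv)
    also have "\<dots> \<le> K * norm (z - \<gamma> s) * norm v"
      using s by (intro lip zU \<gamma>_U) auto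
    also have "\<dots> = c * \<bar>s' - s\<bar>"
      by (simp add: z_def c_def power2_eq_square)
    finally show "norm (\<psi> s' - \<psi> s) \<le> c * \<bar>s' - s\<bar>" .
  qed
  have global: "norm (\<psi> s' - \<psi> s) \<le> (K * norm w * norm v) * \<bar>s' - s\<bar>"
    if "s \<in> {0..1}" "s' \<in> {0..1}" for s s'
  proof -
    have "\<gamma> s' - \<gamma> s = (s' - s) *\<^sub>R w"
      by (simp add: \<gamma>_def algebra_simps)
    with lip[OF \<gamma>_U[OF that(2)] \<gamma>_U[OF that(1)]] show ?thesis
      by (simp add: \<psi>_def mult_ac)
  qed
  have \<psi>_bound: "norm (\<psi> s - \<psi> 0) \<le> c * s" if "0 \<le> s" "s \<le> 1" for s
    using lipschitz_from_local[OF _ local global that] \<open>0 \<le> K\<close> by (simp add: c_def)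
  \<comment> \<open>Integrating the bound \<open>c s\<close> on the derivative of \<open>f\<close> gives the factor one half.\<close>
  define f where "f s = \<Phi> (\<gamma> s) - s *\<^sub>R \<psi> 0" for s
  have f': "(f has_vector_derivative (\<psi> s - \<psi> 0)) (at s)" for s
  proof -
    have "(\<gamma> has_derivative (\<lambda>h. h *\<^sub>R w)) (at s)"
      unfolding \<gamma>_def by (auto intro!: derivative_eq_intros)
    then have "((\<lambda>s. \<Phi> (\<gamma> s)) has_derivative (\<lambda>h. \<Phi>' (\<gamma> s) (h *\<^sub>R w))) (at s)"
      by (rule has_derivative_compose) (rule deriv)
    then have "((\<lambda>s. \<Phi> (\<gamma> s)) has_vector_derivative \<psi> s) (at s)"
      by (simp add: has_vector_derivative_def linear_scale[OF lin] \<psi>_w)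
    then show ?thesis
      unfolding f_def by (auto intro!: derivative_eq_intros)
  qed
  have "norm (f 1 - f 0) \<le> c / 2 * 1\<^sup>2 - c / 2 * 0\<^sup>2"
  proof (rule differentiable_bound_general[of 0 1 f "\<lambda>s. c / 2 * s\<^sup>2" "\<lambda>s. \<psi> s - \<psi> 0" "\<lambda>s. c * s"])
    show "continuous_on {0..1} f"
      using f' by (meson continuous_at_imp_continuous_on has_vector_derivative_continuous)
  qed (auto intro!: f' \<psi>_bound continuous_intros derivative_eq_intros
      simp: has_real_derivative_iff_has_vector_derivative[symmetric])
  moreover have "f 1 - f 0 = \<Phi> \<theta>1 - \<Phi> \<theta>0 - \<Phi>' \<theta>0 (\<theta>1 - \<theta>0)"
    using \<psi>_w[of 0] by (simp add: f_def \<gamma>_def w_def)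
  ultimately show ?thesis
    by (simp add: c_def)
qed

section \<open>Smallest eigenvalues and spectral norms\<close>

text \<open>
  For a symmetric matrix the least eigenvalue is the minimum of the quadratic form on the unit
  sphere: a minimiser \<open>v\<close> exists by compactness and is an eigenvector by the variational argument,
  and every eigenvalue is a value of the form at a unit vector.
\<close>
lemma lambda_min_rayleigh:
  fixes M :: "real^'k^'k"
  assumes sym: "\<And>u v. u \<bullet> (M *v v) = v \<bullet> (M *v u)"
  obtains v where "norm v = 1" and "lambda_min M = v \<bullet> (M *v v)"
    and "\<And>u. lambda_min M * (norm u)\<^sup>2 \<le> u \<bullet> (M *v u)"
proof -
  have ne: "sphere (0::real^'k) 1 \<noteq> {}" by simp
  have cont: "continuous_on (sphere 0 1) (\<lambda>u. u \<bullet> (M *v u))"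
    by (intro continuous_intros matrix_vector_mult_linear_continuous_on)
  obtain v where v: "norm v = 1" and vmin: "\<And>u. norm u = 1 \<Longrightarrow> v \<bullet> (M *v v) \<le> u \<bullet> (M *v u)"
    using continuous_attains_inf[OF compact_sphere ne cont] by auto
  define c where "c = v \<bullet> (M *v v)"
  have ray: "c * (norm u)\<^sup>2 \<le> u \<bullet> (M *v u)" for u
  proof (cases "u = 0")
    case False
    have "c \<le> (inverse (norm u) *\<^sub>R u) \<bullet> (M *v (inverse (norm u) *\<^sub>R u))"
      unfolding c_def using False by (intro vmin) simp
    also have "\<dots> = (inverse (norm u))\<^sup>2 * (u \<bullet> (M *v u))"
      by (simp add: matrix_vector_mult_scaleR power2_eq_square)
    finally have "c * (norm u)\<^sup>2 \<le> (inverse (norm u))\<^sup>2 * (u \<bullet> (M *v u)) * (norm u)\<^sup>2"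
      by (rule mult_right_mono) simp
    also have "\<dots> = u \<bullet> (M *v u)"
      using False by (simp add: field_simps)
    finally show ?thesis .
  qed simp
  define w where "w = M *v v - c *\<^sub>R v"
  have "w = 0"
  proof (rule ccontr)
    assume "w \<noteq> 0"
    define B where "B = w \<bullet> (M *v w) - c * (norm w)\<^sup>2"
    \<comment> \<open>Moving from \<open>v\<close> against the residual \<open>w\<close> by this step would push the form below its minimum.\<close>
    define s where "s = (norm w)\<^sup>2 / (B + 1)"
    have B: "B \<ge> 0" using ray[of w] by (simp add: B_def)
    have s: "s > 0" unfolding s_def using B \<open>w \<noteq> 0\<close> by (intro divide_pos_pos) auto
    have ww: "v \<bullet> (M *v w) - c * (v \<bullet> w) = (norm w)\<^sup>2" 
    proof -
      have "v \<bullet> (M *v w) - c * (v \<bullet> w) = w \<bullet> (M *v v - c *\<^sub>R v)"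
        by (simp add: inner_diff_right sym[of v w] inner_commute[of w v])
      then show ?thesis by (simp add: w_def[symmetric] power2_norm_eq_inner)
    qed
    have "c * (norm (v - s *\<^sub>R w))\<^sup>2 \<le> (v - s *\<^sub>R w) \<bullet> (M *v (v - s *\<^sub>R w))"
      by (rule ray)
    also have "\<dots> = c - 2 * s * (v \<bullet> (M *v w)) + s\<^sup>2 * (w \<bullet> (M *v w))"
      by (simp add: matrix_vector_mult_diff_distrib matrix_vector_mult_scaleR inner_diff_left
          inner_diff_right sym[of w v] power2_eq_square c_def algebra_simps)
    finally have "c * (norm (v - s *\<^sub>R w))\<^sup>2 \<le> c - 2 * s * (v \<bullet> (M *v w)) + s\<^sup>2 * (w \<bullet> (M *v w))" .
    moreover have "(norm (v - s *\<^sub>R w))\<^sup>2 = 1 - 2 * s * (v \<bullet> w) + s\<^sup>2 * (norm w)\<^sup>2"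
      using v unfolding power2_norm_eq_inner
      by (simp add: inner_diff_left inner_diff_right inner_commute[of w v] norm_eq_1 power2_eq_square algebra_simps)
    ultimately have "2 * s * (v \<bullet> (M *v w) - c * (v \<bullet> w)) \<le> s\<^sup>2 * B"
      by (simp add: B_def algebra_simps)
    then have "s * (2 * (norm w)\<^sup>2) \<le> s * (s * B)"
      by (simp add: ww power2_eq_square mult_ac)
    then have "2 * (norm w)\<^sup>2 \<le> s * B"
      using s by simp
    also have "s * B = (norm w)\<^sup>2 * (B / (B + 1))"
      by (simp add: s_def)
    also have "\<dots> \<le> (norm w)\<^sup>2 * 1"
      using B by (intro mult_left_mono) auto
    finally show False using \<open>w \<noteq> 0\<close> by simp
  qed
  then have eig: "M *v v = c *\<^sub>R v" by (simp add: w_def)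
  have "lambda_min M = c"
    unfolding lambda_min_def
  proof (rule Least_equality)
    show "\<exists>v. v \<noteq> 0 \<and> M *v v = c *\<^sub>R v"
      using eig v by (intro exI[of _ v]) auto
    fix c' assume "\<exists>u. u \<noteq> 0 \<and> M *v u = c' *\<^sub>R u"
    then obtain u where u: "u \<noteq> 0" "M *v u = c' *\<^sub>R u" by blast
    have "c * (norm u)\<^sup>2 \<le> c' * (norm u)\<^sup>2"
      using ray[of u] by (simp add: u power2_norm_eq_inner)
    then show "c \<le> c'" using u by simp
  qed
  with v ray show ?thesis
    by (intro that[of v]) (auto simp: c_def)
qed

lemma norm_matrix_vector_le_spec_norm: "norm (M *v v) \<le> spec_norm M * norm v"
  unfolding spec_norm_def by (rule onorm) (rule matrix_vector_mul_bounded_linear)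

lemma spec_norm_nonneg: "0 \<le> spec_norm M"
  unfolding spec_norm_def by (rule onorm_pos_le) (rule matrix_vector_mul_bounded_linear)

section \<open>Bounded Lipschitz functions\<close>

text \<open>
  Boundedness is part of the notion because it makes the class closed under products. One constant
  serves as the bound and as the Lipschitz constant, which loses nothing.
\<close>
definition bounded_lipschitz :: "('a::metric_space \<Rightarrow> real) \<Rightarrow> bool" where
  "bounded_lipschitz f \<longleftrightarrow> (\<exists>C. \<forall>x y. \<bar>f x\<bar> \<le> C \<and> \<bar>f x - f y\<bar> \<le> C * dist x y)"

lemma bounded_lipschitzI:
  assumes "\<And>x. \<bar>f x\<bar> \<le> C" and "\<And>x y. \<bar>f x - f y\<bar> \<le> D * dist x y"
  shows "bounded_lipschitz f"
  unfolding bounded_lipschitz_def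
proof (intro exI allI conjI)
  fix x y
  show "\<bar>f x\<bar> \<le> max C D" using assms(1)[of x] by simp
  show "\<bar>f x - f y\<bar> \<le> max C D * dist x y"
    using assms(2)[of x y] by (rule order_trans) (simp add: mult_right_mono)
qed

lemma bounded_lipschitzE:
  assumes "bounded_lipschitz f"
  obtains C where "\<And>x. \<bar>f x\<bar> \<le> C" and "\<And>x y. \<bar>f x - f y\<bar> \<le> C * dist x y" and "0 \<le> C"
  using assms unfolding bounded_lipschitz_def by (metis abs_ge_zero order_trans)

lemma bounded_lipschitz_const [intro]: "bounded_lipschitz (\<lambda>x. c)"
  by (rule bounded_lipschitzI[of _ "\<bar>c\<bar>" 0]) auto

lemma bounded_lipschitz_diff [intro]:
  assumes "bounded_lipschitz f" "bounded_lipschitz g"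
  shows "bounded_lipschitz (\<lambda>x. f x - g x)"
proof -
  obtain C D where C: "\<And>x. \<bar>f x\<bar> \<le> C" "\<And>x y. \<bar>f x - f y\<bar> \<le> C * dist x y"
    and D: "\<And>x. \<bar>g x\<bar> \<le> D" "\<And>x y. \<bar>g x - g y\<bar> \<le> D * dist x y"
    using assms by (metis bounded_lipschitzE)
  show ?thesis
  proof (rule bounded_lipschitzI)
    fix x y
    show "\<bar>f x - g x\<bar> \<le> C + D" using C(1)[of x] D(1)[of x] by linarith
    show "\<bar>f x - g x - (f y - g y)\<bar> \<le> (C + D) * dist x y"
      using C(2)[of x y] D(2)[of x y] unfolding distrib_right by linarith
  qed
qed

lemma bounded_lipschitz_add [intro]:
  assumes "bounded_lipschitz f" "bounded_lipschitz g"
  shows "bounded_lipschitz (\<lambda>x. f x + g x)"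
proof -
  have "bounded_lipschitz (\<lambda>x. f x - (0 - g x))"
    by (intro bounded_lipschitz_diff bounded_lipschitz_const assms)
  then show ?thesis by simp
qed

lemma bounded_lipschitz_mult [intro]:
  assumes "bounded_lipschitz f" "bounded_lipschitz g"
  shows "bounded_lipschitz (\<lambda>x. f x * g x)"
proof -
  obtain C D where C: "\<And>x. \<bar>f x\<bar> \<le> C" "\<And>x y. \<bar>f x - f y\<bar> \<le> C * dist x y" "0 \<le> C"
    and D: "\<And>x. \<bar>g x\<bar> \<le> D" "\<And>x y. \<bar>g x - g y\<bar> \<le> D * dist x y" "0 \<le> D"
    using assms by (metis bounded_lipschitzE)
  show ?thesis
  proof (rule bounded_lipschitzI)
    fix x y
    show "\<bar>f x * g x\<bar> \<le> C * D"
      unfolding abs_mult using C D by (intro mult_mono) auto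
    have "\<bar>f x * g x - f y * g y\<bar> = \<bar>f x * (g x - g y) + (f x - f y) * g y\<bar>"
      by (simp add: algebra_simps)
    also have "\<dots> \<le> \<bar>f x\<bar> * \<bar>g x - g y\<bar> + \<bar>f x - f y\<bar> * \<bar>g y\<bar>"
      by (metis abs_mult abs_triangle_ineq)
    also have "\<dots> \<le> C * (D * dist x y) + (C * dist x y) * D"
      using C D by (intro add_mono mult_mono) auto
    finally show "\<bar>f x * g x - f y * g y\<bar> \<le> (2 * C * D) * dist x y"
      by (simp add: algebra_simps)
  qed
qed

lemma bounded_lipschitz_sum [intro]:
  assumes "\<And>i. i \<in> I \<Longrightarrow> bounded_lipschitz (f i)"
  shows "bounded_lipschitz (\<lambda>x. \<Sum>i\<in>I. f i x)"
  using assms by (induction I rule: infinite_finite_induct) (auto simp: bounded_lipschitz_const)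

text \<open>The spectral norm is at most the sum of the absolute values of the entries.\<close>
lemma bounded_lipschitz_matrix:
  fixes M :: "'a::metric_space \<Rightarrow> real^'k^'l"
  assumes "\<And>i j. bounded_lipschitz (\<lambda>x. M x $ i $ j)"
  obtains C where "\<And>x. spec_norm (M x) \<le> C" and "\<And>x y. spec_norm (M x - M y) \<le> C * dist x y"
    and "0 \<le> C"
proof -
  obtain C where C: "\<And>i j x. \<bar>M x $ i $ j\<bar> \<le> C i j"
    "\<And>i j x y. \<bar>M x $ i $ j - M y $ i $ j\<bar> \<le> C i j * dist x y"
    using assms unfolding bounded_lipschitz_def by metis
  have "spec_norm (M x) \<le> (\<Sum>i\<in>UNIV. \<Sum>j\<in>UNIV. C i j)" for x
    unfolding spec_norm_def
    by (rule order_trans[OF onorm_le_matrix_component_sum]) (intro sum_mono C)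
  moreover have "spec_norm (M x - M y) \<le> (\<Sum>i\<in>UNIV. \<Sum>j\<in>UNIV. C i j) * dist x y" for x y
    unfolding spec_norm_def sum_distrib_right
    by (rule order_trans[OF onorm_le_matrix_component_sum]) (auto intro!: sum_mono C)
  ultimately show ?thesis
    using spec_norm_nonneg order_trans that by metis
qed

section \<open>Directions that leave the choice probabilities unchanged\<close>

text \<open>
  These are the directions along which all utilities of the sample stay constant. The choice
  probabilities, and with them their Jacobians and the Hessian of the loss, are invariant under
  translation along them.
\<close>
lemma choice_null_iff: "v \<in> choice_null a S \<longleftrightarrow> (\<forall>i\<in>S. \<forall>j. a i j \<bullet> v = 0)"
proof -
  have "attr_matrix a i *v v = (\<chi> j. a i j \<bullet> v)" for i
    by (simp add: attr_matrix_def matrix_vector_mult_def inner_vec_def)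
  then show ?thesis
    by (auto simp: choice_null_def vec_eq_iff)
qed

lemma mean_attr_choice_null:
  assumes "v \<in> choice_null a S" "i \<in> S"
  shows "mean_attr a i \<theta> \<bullet> v = 0"
  using assms by (simp add: choice_null_iff inner_mean_attr)

lemma choice_prob_add_null:
  assumes "v \<in> choice_null a S" "i \<in> S"
  shows "choice_prob a i (\<theta> + v) = choice_prob a i \<theta>"
  using assms by (simp add: choice_null_iff choice_prob_def inner_add_right)

lemma choice_jac_mult_null:
  assumes "v \<in> choice_null a S" "i \<in> S"
  shows "choice_jac a i \<theta> *v v = 0"
  using assms mean_attr_choice_null[OF assms]
  by (simp add: choice_null_iff choice_jac_mult inner_diff_left vec_eq_iff)

lemma choice_jac_add_null:
  assumes "v \<in> choice_null a S" "i \<in> S"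
  shows "choice_jac a i (\<theta> + v) = choice_jac a i \<theta>"
  unfolding matrix_eq
  by (simp add: choice_jac_mult mean_attr_def choice_prob_add_null[OF assms])

lemma hessian_mult_null:
  assumes "v \<in> choice_null a S"
  shows "hessian (loss a y S) \<theta> *v v = 0"
  using assms mean_attr_choice_null[OF assms]
  by (simp add: choice_null_iff hessian_loss_mult inner_diff_left)

lemma hessian_add_null:
  assumes "v \<in> choice_null a S"
  shows "hessian (loss a y S) (\<theta> + v) = hessian (loss a y S) \<theta>"
  unfolding matrix_eq
  by (auto simp: hessian_loss_mult mean_attr_def choice_prob_add_null[OF assms] intro!: sum.cong)

lemma hessian_sym:
  "u \<bullet> (hessian (loss a y S) \<theta> *v v) = v \<bullet> (hessian (loss a y S) \<theta> *v u)"
  by (simp add: hessian_loss_form mult_ac)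

text \<open>
  A vanishing variance means that the utilities \<open>a\<^sub>i\<^sub>j \<bullet> v\<close> agree over all alternatives \<open>j\<close>.
  Their common value is that of the outside option, which is \<open>0\<close>; this is where the normalisation
  of the outside option enters.
\<close>
lemma hessian_null_quadratic:
  assumes "finite S" and outside: "\<And>i. a i None = 0"
    and zero: "v \<bullet> (hessian (loss a y S) \<theta> *v v) \<le> 0"
  shows "v \<in> choice_null a S"
proof -
  let ?f = "\<lambda>i j. choice_prob a i \<theta> $ j * ((a i j - mean_attr a i \<theta>) \<bullet> v) * ((a i j - mean_attr a i \<theta>) \<bullet> v)"
  have nonneg: "0 \<le> ?f i j" for i j
    using choice_prob_pos[of a i \<theta> j] by (simp add: mult.assoc)
  have "(\<Sum>i\<in>S. \<Sum>j\<in>UNIV. ?f i j) = 0"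
    using zero nonneg unfolding hessian_loss_form by (intro antisym sum_nonneg) auto
  then have "(\<Sum>j\<in>UNIV. ?f i j) = 0" if "i \<in> S" for i
    using that nonneg \<open>finite S\<close> by (subst (asm) sum_nonneg_eq_0_iff) (auto intro!: sum_nonneg)
  then have f0: "?f i j = 0" if "i \<in> S" for i j
    using that nonneg by (subst (asm) sum_nonneg_eq_0_iff) auto
  have *: "a i j \<bullet> v = mean_attr a i \<theta> \<bullet> v" if "i \<in> S" for i j
    using f0[OF that, of j] choice_prob_pos[of a i \<theta> j] by (auto simp: inner_diff_left)
  have "a i j \<bullet> v = 0" if "i \<in> S" for i j
    using *[OF that, of j] *[OF that, of None] outside[of i] by simp
  then show ?thesis by (simp add: choice_null_iff)
qed

section \<open>Orthonormal coordinates on the identified directions\<close>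

lemma subspace_face_tangent: "subspace (face_tangent A R)"
  unfolding subspace_def face_tangent_def
  by (auto simp: matrix_vector_right_distrib matrix_vector_mult_scaleR)

lemma subspace_choice_null: "subspace (choice_null a S)"
  by (auto simp: subspace_def choice_null_iff inner_add_right)

lemma inner_transpose_matrix:
  fixes Z :: "real^'k^'n"
  shows "u \<bullet> (transpose Z *v x) = (Z *v u) \<bullet> x"
  by (metis dot_lmul_matrix inner_commute transpose_matrix_vector)

lemma norm_orthonormal_columns:
  fixes Z :: "real^'k^'n"
  assumes "transpose Z ** Z = mat 1"
  shows "norm (Z *v u) = norm u"
proof -
  have "(Z *v u) \<bullet> (Z *v u) = u \<bullet> (transpose Z *v (Z *v u))"
    by (rule inner_transpose_matrix[symmetric])
  also have "\<dots> = u \<bullet> u"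
    by (simp only: matrix_vector_mul_assoc assms matrix_vector_mul_lid)
  finally show ?thesis
    by (simp add: norm_eq_sqrt_inner)
qed

lemma matrix_vector_in_ident_space:
  assumes "span (columns Z) = ident_space a S A R"
  shows "Z *v u \<in> ident_space a S A R"
  using matrix_vector_mult_in_columnspace[of Z u] assms by simp

text \<open>
  Orthogonal projection onto the tangential null directions: the complementary part lies in the
  identified space, and by Pythagoras its coordinate vector \<open>u\<close> is no longer than \<open>v\<close>.
\<close>
lemma tangent_decomposition:
  fixes Z :: "real^'k^'n"
  assumes ortho: "transpose Z ** Z = mat 1"
    and Z: "span (columns Z) = ident_space a S A R" and v: "v \<in> face_tangent A R"
  obtains \<kappa> u where "\<kappa> \<in> choice_null a S" and "v = \<kappa> + Z *v u" and "norm u \<le> norm v"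
proof -
  let ?K = "face_tangent A R \<inter> choice_null a S"
  have K: "subspace ?K"
    by (intro subspace_inter subspace_face_tangent subspace_choice_null)
  obtain \<kappa> z where \<kappa>: "\<kappa> \<in> ?K" and z: "z \<in> orthogonal_comp ?K" and vk: "v = \<kappa> + z"
    using subspace_sum_orthogonal_comp[OF K] by (metis UNIV_I set_plus_elim)
  have "z = v - \<kappa>" using vk by simp
  then have "z \<in> face_tangent A R"
    using v \<kappa> by (auto intro: subspace_diff[OF subspace_face_tangent])
  with z have "z \<in> span (columns Z)"
    by (simp add: Z ident_space_def)
  then obtain u where u: "z = Z *v u"
    unfolding columns_image_basis
    by (subst (asm) linear_span_image[OF matrix_vector_mul_linear]) auto
  have "orthogonal \<kappa> z"
    using z \<kappa> by (auto simp: orthogonal_comp_def)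
  then have "(norm v)\<^sup>2 = (norm \<kappa>)\<^sup>2 + (norm z)\<^sup>2"
    unfolding vk by (rule norm_add_Pythagorean)
  then have "norm z \<le> norm v"
    by (metis le_add_same_cancel2 norm_ge_zero power2_le_imp_le zero_le_power2)
  with \<kappa> vk u show ?thesis
    using norm_orthonormal_columns[OF ortho] by (intro that[of \<kappa> u]) auto
qed

section \<open>Regularity of the choice probabilities and of the Hessian\<close>

text \<open>The derivative is globally bounded, since probabilities are at most \<open>1\<close> and there are finitely many attributes.\<close>
lemma bounded_lipschitz_choice_prob: "bounded_lipschitz (\<lambda>\<theta>. choice_prob a i \<theta> $ j)"
proof (rule bounded_lipschitzI)
  define B where "B = norm (a i j) + (\<Sum>l\<in>UNIV. norm (a i l))"
  show "\<bar>choice_prob a i \<theta> $ j\<bar> \<le> 1" for \<theta>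
    using choice_prob_pos[of a i \<theta> j] choice_prob_le_1[of a i \<theta> j] by simp
  have slope: "onorm (\<lambda>h. choice_prob a i \<theta> $ j * ((a i j - mean_attr a i \<theta>) \<bullet> h)) \<le> B" for \<theta>
  proof (rule onorm_le)
    fix h
    have "norm (mean_attr a i \<theta>) \<le> (\<Sum>l\<in>UNIV. norm (a i l))"
      unfolding mean_attr_def
    proof (rule order_trans[OF norm_sum sum_mono])
      fix l
      show "norm (choice_prob a i \<theta> $ l *\<^sub>R a i l) \<le> norm (a i l)"
        using choice_prob_pos[of a i \<theta> l] choice_prob_le_1[of a i \<theta> l]
        by (simp add: mult_left_le_one_le)
    qed
    then have "norm (a i j - mean_attr a i \<theta>) \<le> B"
      unfolding B_def using norm_triangle_ineq4[of "a i j" "mean_attr a i \<theta>"] by linarith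
    then have "\<bar>(a i j - mean_attr a i \<theta>) \<bullet> h\<bar> \<le> B * norm h"
      by (meson Cauchy_Schwarz_ineq2 mult_right_mono norm_ge_zero order_trans)
    then have "\<bar>choice_prob a i \<theta> $ j\<bar> * \<bar>(a i j - mean_attr a i \<theta>) \<bullet> h\<bar> \<le> 1 * (B * norm h)"
      using choice_prob_pos[of a i \<theta> j] choice_prob_le_1[of a i \<theta> j] by (intro mult_mono) auto
    then show "norm (choice_prob a i \<theta> $ j * ((a i j - mean_attr a i \<theta>) \<bullet> h)) \<le> B * norm h"
      by (simp add: abs_mult)
  qed
  show "\<bar>choice_prob a i x $ j - choice_prob a i y $ j\<bar> \<le> B * dist x y" for x y
    using differentiable_bound[OF convex_UNIV has_derivative_choice_prob_nth slope, of x y]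
    by (simp add: dist_norm)
qed

lemma bounded_lipschitz_centred:
  "bounded_lipschitz (\<lambda>\<theta>. (a i j - mean_attr a i \<theta>) \<bullet> v)"
  unfolding inner_diff_left inner_mean_attr
  by (intro bounded_lipschitz_diff bounded_lipschitz_const bounded_lipschitz_sum
      bounded_lipschitz_mult bounded_lipschitz_choice_prob)

lemma matrix_mult_nth_column: "(M ** Z) $ i $ k = (M *v column k Z) $ i"
  by (simp add: matrix_matrix_mult_def matrix_vector_mult_def column_def)

lemma transpose_mult_nth:
  fixes Z :: "real^'k^'n"
  shows "(transpose Z *v x) $ k = column k Z \<bullet> x"
proof -
  have "transpose Z $ k = column k Z"
    by (simp add: transpose_def column_def vec_eq_iff)
  then show ?thesis
    by (simp add: matrix_mult_dot[of "transpose Z"] del: transpose_matrix_vector)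
qed

text \<open>Every entry is a polynomial in choice probabilities, so one constant serves on the whole space.\<close>
lemma choice_jac_lipschitz:
  obtains C where "\<And>\<theta>. spec_norm (choice_jac a i \<theta> ** Z) \<le> C"
    and "\<And>\<theta> \<theta>'. spec_norm ((choice_jac a i \<theta> - choice_jac a i \<theta>') ** Z) \<le> C * norm (\<theta> - \<theta>')"
    and "0 \<le> C"
proof -
  have entries: "bounded_lipschitz (\<lambda>\<theta>. (choice_jac a i \<theta> ** Z) $ j $ k)" for j k
    unfolding matrix_mult_nth_column choice_jac_mult vec_lambda_beta
    by (intro bounded_lipschitz_mult bounded_lipschitz_choice_prob bounded_lipschitz_centred)
  have diff: "(choice_jac a i \<theta> - choice_jac a i \<theta>') ** Z = choice_jac a i \<theta> ** Z - choice_jac a i \<theta>' ** Z" for \<theta> \<theta>'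
    by (simp add: matrix_eq matrix_vector_mul_assoc[symmetric] matrix_vector_mult_diff_rdistrib)
  show ?thesis
    by (rule bounded_lipschitz_matrix[OF entries]) (metis that diff dist_norm)
qed

lemma hessian_lipschitz:
  obtains C where
    "\<And>\<theta> \<theta>'. spec_norm (transpose Z ** (hessian (loss a y S) \<theta> - hessian (loss a y S) \<theta>') ** Z)
        \<le> C * norm (\<theta> - \<theta>')"
    and "0 \<le> C"
proof -
  let ?M = "\<lambda>\<theta>. transpose Z ** hessian (loss a y S) \<theta> ** Z"
  have entry: "?M \<theta> $ k $ l = column k Z \<bullet> (hessian (loss a y S) \<theta> *v column l Z)" for \<theta> k l
    by (simp add: matrix_mult_nth_column matrix_vector_mul_assoc[symmetric] transpose_mult_nth
        del: transpose_matrix_vector)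
  have entries: "bounded_lipschitz (\<lambda>\<theta>. ?M \<theta> $ k $ l)" for k l
    unfolding entry hessian_loss_form
    by (intro bounded_lipschitz_sum bounded_lipschitz_mult bounded_lipschitz_choice_prob
        bounded_lipschitz_centred)
  have diff: "transpose Z ** (hessian (loss a y S) \<theta> - hessian (loss a y S) \<theta>') ** Z = ?M \<theta> - ?M \<theta>'" for \<theta> \<theta>'
    by (simp add: matrix_eq matrix_vector_mul_assoc[symmetric] matrix_vector_mult_diff_rdistrib
        matrix_vector_mult_diff_distrib del: transpose_matrix_vector)
  show ?thesis
    by (rule bounded_lipschitz_matrix[OF entries]) (metis that diff dist_norm)
qed

lemma reduced_hessian_form:
  fixes Z :: "real^'k^'n"
  shows "u \<bullet> ((transpose Z ** M ** Z) *v v) = (Z *v u) \<bullet> (M *v (Z *v v))"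
  by (simp add: matrix_vector_mul_assoc[symmetric] inner_transpose_matrix del: transpose_matrix_vector)

text \<open>
  An identified direction on which the Hessian vanishes would be a null direction, hence orthogonal to
  itself.
\<close>
lemma lambda_min_reduced_hessian_pos:
  fixes Z :: "real^'k^'n"
  assumes "finite S" and "\<And>i. a i None = 0" and "transpose Z ** Z = mat 1"
    and Z: "span (columns Z) = ident_space a S A R"
  shows "0 < lambda_min (transpose Z ** hessian (loss a y S) \<theta> ** Z)"
proof (rule ccontr)
  assume neg: "\<not> ?thesis"
  obtain v where v: "norm v = 1"
    "lambda_min (transpose Z ** hessian (loss a y S) \<theta> ** Z) = v \<bullet> ((transpose Z ** hessian (loss a y S) \<theta> ** Z) *v v)"
    by (rule lambda_min_rayleigh[where M = "transpose Z ** hessian (loss a y S) \<theta> ** Z"])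
      (auto simp: reduced_hessian_form intro: hessian_sym)
  have "Z *v v \<in> choice_null a S"
    using neg v(2) by (intro hessian_null_quadratic[of S a _ y \<theta>] assms) (simp add: reduced_hessian_form)
  moreover have "Z *v v \<in> ident_space a S A R"
    using Z by (rule matrix_vector_in_ident_space)
  ultimately have "orthogonal (Z *v v) (Z *v v)"
    unfolding ident_space_def orthogonal_comp_def by auto
  then show False
    using norm_orthonormal_columns[OF assms(3), of v] v(1) by (simp add: orthogonal_self)
qed

text \<open>
  The least eigenvalue is a minimum of quadratic forms and so inherits their Lipschitz dependence on
  the parameter; positivity at one point persists nearby.
\<close>
lemma lambda_min_reduced_hessian_locally_bounded:
  fixes Z :: "real^'k^'n"
  assumes "finite S" and "\<And>i. a i None = 0" and "transpose Z ** Z = mat 1"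
    and "span (columns Z) = ident_space a S A R"
  obtains \<epsilon> c where "0 < \<epsilon>" and "0 < c"
    and "\<And>\<theta>. norm (\<theta> - \<theta>0) < \<epsilon> \<Longrightarrow> c \<le> lambda_min (transpose Z ** hessian (loss a y S) \<theta> ** Z)"
proof -
  let ?M = "\<lambda>\<theta>. transpose Z ** hessian (loss a y S) \<theta> ** Z"
  have sym: "u \<bullet> (?M \<theta> *v v) = v \<bullet> (?M \<theta> *v u)" for u v \<theta>
    unfolding reduced_hessian_form by (rule hessian_sym)
  obtain C where C: "\<And>\<theta> \<theta>'. spec_norm (transpose Z ** (hessian (loss a y S) \<theta> - hessian (loss a y S) \<theta>') ** Z)
        \<le> C * norm (\<theta> - \<theta>')" "0 \<le> C"
    using hessian_lipschitz by blast
  define c where "c = lambda_min (?M \<theta>0)"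
  have c: "0 < c"
    unfolding c_def using assms by (rule lambda_min_reduced_hessian_pos)
  have low: "c \<le> lambda_min (?M \<theta>) + C * norm (\<theta>0 - \<theta>)" for \<theta>
  proof -
    obtain v where v: "norm v = 1" "lambda_min (?M \<theta>) = v \<bullet> (?M \<theta> *v v)"
      using lambda_min_rayleigh[OF sym] by blast
    have "c \<le> v \<bullet> (?M \<theta>0 *v v)"
      unfolding c_def using v(1) by (rule_tac lambda_min_rayleigh[OF sym, of \<theta>0]) (metis mult.right_neutral one_power2)
    also have "\<dots> = lambda_min (?M \<theta>) + v \<bullet> ((transpose Z ** (hessian (loss a y S) \<theta>0 - hessian (loss a y S) \<theta>) ** Z) *v v)"
      unfolding v(2) reduced_hessian_form by (simp add: matrix_vector_mult_diff_rdistrib inner_diff_right)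
    also have "\<dots> \<le> lambda_min (?M \<theta>) + C * norm (\<theta>0 - \<theta>)"
      using norm_cauchy_schwarz[of v] v(1) C(1)[of \<theta>0 \<theta>] norm_matrix_vector_le_spec_norm[of _ v]
      by (smt (verit, ccfv_threshold) mult_cancel_left1 mult_cancel_right2)
    finally show ?thesis .
  qed
  show ?thesis
  proof (rule that)
    show "0 < c / (2 * (C + 1))" "0 < c / 2" using c C(2) by auto
    fix \<theta> assume "norm (\<theta> - \<theta>0) < c / (2 * (C + 1))"
    then have "(C + 1) * norm (\<theta>0 - \<theta>) < c / 2"
      using C(2) by (simp add: pos_less_divide_eq norm_minus_commute algebra_simps)
    moreover have "C * norm (\<theta>0 - \<theta>) \<le> (C + 1) * norm (\<theta>0 - \<theta>)"
      by (intro mult_right_mono) auto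
    ultimately show "c / 2 \<le> lambda_min (?M \<theta>)"
      using low[of \<theta>] by simp
  qed
qed

section \<open>The active face\<close>

lemma active_face_diff:
  assumes "\<theta> \<in> active_face A b R" "\<theta>' \<in> active_face A b R"
  shows "\<theta> - \<theta>' \<in> face_tangent A R"
  using assms by (simp add: active_face_def face_tangent_def matrix_vector_mult_diff_distrib)

text \<open>The inactive constraints are strict at \<open>\<theta>0\<close> and stay strict nearby.\<close>
lemma active_face_relatively_open:
  fixes A :: "real^'n^'m"
  assumes "\<theta>0 \<in> polyhedron_of A b"
  obtains \<rho> where "0 < \<rho>"
    and "\<And>h. h \<in> face_tangent A (active_set A b \<theta>0) \<Longrightarrow> norm h < \<rho> \<Longrightarrow>
      \<theta>0 + h \<in> active_face A b (active_set A b \<theta>0)"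
proof -
  let ?R = "active_set A b \<theta>0"
  define V where "V = (\<Inter>r\<in>-?R. {\<theta>. (A *v \<theta>) $ r < b $ r})"
  have "open V"
    unfolding V_def
    by (intro open_INT ballI open_Collect_less continuous_intros matrix_vector_mult_linear_continuous_on) auto
  moreover have "\<theta>0 \<in> V"
    using assms unfolding V_def active_set_def polyhedron_of_def less_eq_vec_def
    by (auto simp: order.strict_iff_order)
  ultimately obtain \<rho> where \<rho>: "\<rho> > 0" "ball \<theta>0 \<rho> \<subseteq> V"
    by (meson openE)
  show ?thesis
  proof (rule that[OF \<rho>(1)])
    fix h assume h: "h \<in> face_tangent A ?R" "norm h < \<rho>"
    have "\<theta>0 + h \<in> V"
      using \<rho> h by (auto simp: dist_norm subset_iff)
    then have out: "(A *v (\<theta>0 + h)) $ r < b $ r" if "r \<notin> ?R" for r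
      using that by (auto simp: V_def)
    have on: "(A *v (\<theta>0 + h)) $ r = b $ r" if "r \<in> ?R" for r
      using that h(1) by (simp add: face_tangent_def matrix_vector_right_distrib active_set_def)
    have "(A *v (\<theta>0 + h)) $ r \<le> b $ r" for r
      using out on by (cases "r \<in> ?R") (auto intro: less_imp_le)
    then show "\<theta>0 + h \<in> active_face A b ?R"
      using on by (simp add: active_face_def polyhedron_of_def less_eq_vec_def)
  qed
qed

lemma nhd_within_active_face:
  fixes A :: "real^'n^'m"
  assumes "\<theta>0 \<in> polyhedron_of A b" and nhd: "nhd_within (active_face A b (active_set A b \<theta>0)) \<theta>0 U"
  obtains r where "0 < r"
    and "\<And>h. h \<in> face_tangent A (active_set A b \<theta>0) \<Longrightarrow> norm h < r \<Longrightarrow> \<theta>0 + h \<in> U"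
proof -
  let ?X = "active_face A b (active_set A b \<theta>0)"
  obtain W where W: "openin (top_of_set ?X) W" "\<theta>0 \<in> W" "W \<subseteq> U"
    using nhd unfolding nhd_within_def by blast
  obtain e where e: "e > 0" "ball \<theta>0 e \<inter> ?X \<subseteq> W"
    using W(1,2) unfolding openin_contains_ball by blast
  obtain \<rho> where \<rho>: "0 < \<rho>" "\<And>h. h \<in> face_tangent A (active_set A b \<theta>0) \<Longrightarrow> norm h < \<rho> \<Longrightarrow> \<theta>0 + h \<in> ?X"
    using active_face_relatively_open[OF assms(1)] by blast
  show ?thesis
  proof (rule that[of "min e \<rho>"])
    show "0 < min e \<rho>" using e \<rho> by simp
    fix h assume "h \<in> face_tangent A (active_set A b \<theta>0)" "norm h < min e \<rho>"
    then have "\<theta>0 + h \<in> ball \<theta>0 e \<inter> ?X"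
      using \<rho>(2)[of h] by (simp add: dist_norm)
    then show "\<theta>0 + h \<in> U"
      using e(2) W(3) by blast
  qed
qed

text \<open>A short tangential move from the optimizer is feasible in both directions, so the loss is stationary along it.\<close>
lemma gradient_orthogonal_tangent:
  fixes A :: "real^'n^'m"
  assumes min: "is_arg_min (loss a y S) (\<lambda>\<theta>. \<theta> \<in> polyhedron_of A b) \<theta>0"
    and h: "h \<in> face_tangent A (active_set A b \<theta>0)"
  shows "gradient (loss a y S) \<theta>0 \<bullet> h = 0"
proof -
  have feas: "\<theta>0 \<in> polyhedron_of A b"
    using min by (simp add: is_arg_min_def)
  obtain \<rho> where \<rho>: "0 < \<rho>" "\<And>h. h \<in> face_tangent A (active_set A b \<theta>0) \<Longrightarrow> norm h < \<rho> \<Longrightarrow>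
      \<theta>0 + h \<in> active_face A b (active_set A b \<theta>0)"
    using active_face_relatively_open[OF feas] by blast
  define f where "f s = loss a y S (\<theta>0 + s *\<^sub>R h)" for s
  have "((\<lambda>s. \<theta>0 + s *\<^sub>R h) has_derivative (\<lambda>s. s *\<^sub>R h)) (at 0)"
    by (auto intro!: derivative_eq_intros)
  then have "(f has_derivative (\<lambda>s. gradient (loss a y S) (\<theta>0 + 0 *\<^sub>R h) \<bullet> (s *\<^sub>R h))) (at 0)"
    unfolding f_def gradient_loss by (rule has_derivative_compose) (rule has_derivative_loss)
  then have "DERIV f 0 :> gradient (loss a y S) \<theta>0 \<bullet> h"
    by (simp add: has_field_derivative_def mult.commute[of _ "_ \<bullet> _"] fun_eq_iff has_derivative_def)
  moreover have "0 < \<rho> / (norm h + 1)"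
    using \<rho> by (simp add: add_nonneg_pos)
  moreover have "\<forall>s. \<bar>0 - s\<bar> < \<rho> / (norm h + 1) \<longrightarrow> f 0 \<le> f s"
  proof (intro allI impI)
    fix s :: real assume "\<bar>0 - s\<bar> < \<rho> / (norm h + 1)"
    then have "\<bar>s\<bar> * (norm h + 1) < \<rho>"
      by (simp add: pos_less_divide_eq add_nonneg_pos)
    then have "norm (s *\<^sub>R h) < \<rho>"
      by (simp add: algebra_simps)
    moreover have "s *\<^sub>R h \<in> face_tangent A (active_set A b \<theta>0)"
      using h by (rule subspace_scale[OF subspace_face_tangent])
    ultimately have "\<theta>0 + s *\<^sub>R h \<in> polyhedron_of A b"
      using \<rho>(2) by (auto simp: active_face_def)
    then show "f 0 \<le> f s"
      using min by (force simp: f_def is_arg_min_def not_less)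
  qed
  ultimately show ?thesis
    by (rule DERIV_local_min)
qed

section \<open>The dual gap as a relative entropy\<close>

text \<open>Gibbs' inequality, by summing \<open>q ln (q / \<pi>) \<ge> q - \<pi>\<close>; the terms with \<open>q = 0\<close> are \<open>0\<close>.\<close>
lemma kl_div_nonneg:
  fixes q \<pi> :: "real^'k"
  assumes q: "\<And>j. 0 \<le> q $ j" and \<pi>: "\<And>j. 0 < \<pi> $ j"
    and "(\<Sum>j\<in>UNIV. q $ j) = 1" and "(\<Sum>j\<in>UNIV. \<pi> $ j) = 1"
  shows "0 \<le> kl_div q \<pi>"
proof -
  have "q $ j - \<pi> $ j \<le> q $ j * ln (q $ j / \<pi> $ j)" for j
  proof (cases "q $ j = 0")
    case False
    then have qj: "q $ j > 0" using q[of j] by simp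
    have "ln (\<pi> $ j / q $ j) \<le> \<pi> $ j / q $ j - 1"
      using qj \<pi>[of j] by (intro ln_le_minus_one) simp
    then have "q $ j * ln (\<pi> $ j / q $ j) \<le> q $ j * (\<pi> $ j / q $ j - 1)"
      using qj by (intro mult_left_mono) auto
    also have "\<dots> = \<pi> $ j - q $ j"
      using qj by (simp add: field_simps)
    finally show ?thesis
      using qj \<pi>[of j] by (simp add: ln_div algebra_simps)
  qed (use \<pi>[of j] in auto)
  then have "(\<Sum>j\<in>UNIV. q $ j - \<pi> $ j) \<le> kl_div q \<pi>"
    unfolding kl_div_def by (rule sum_mono)
  then show ?thesis
    using assms by (simp add: sum_subtractf)
qed

text \<open>From \<open>ln x \<le> x - 1\<close> the relative entropy is at most the chi-square distance, whose denominators are at least \<open>c\<close>.\<close>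
lemma kl_div_le_chi_square:
  fixes q \<pi> :: "real^'k"
  assumes q: "\<And>j. 0 \<le> q $ j" and \<pi>: "\<And>j. c \<le> \<pi> $ j" "0 < c"
    and "(\<Sum>j\<in>UNIV. q $ j) = 1" and "(\<Sum>j\<in>UNIV. \<pi> $ j) = 1"
  shows "kl_div q \<pi> \<le> (norm (q - \<pi>))\<^sup>2 / c"
proof -
  have \<pi>_pos: "0 < \<pi> $ j" for j
    using \<pi>(1)[of j] \<pi>(2) by linarith
  have "q $ j * ln (q $ j / \<pi> $ j) \<le> ((q - \<pi>) $ j)\<^sup>2 / c + (q $ j - \<pi> $ j)" for j
  proof -
    have "q $ j * ln (q $ j / \<pi> $ j) \<le> q $ j * (q $ j / \<pi> $ j - 1)"
    proof (cases "q $ j = 0")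
      case False
      then show ?thesis
        using q[of j] \<pi>_pos[of j] by (intro mult_left_mono ln_le_minus_one) auto
    qed simp
    also have "\<dots> = ((q - \<pi>) $ j)\<^sup>2 / \<pi> $ j + (q $ j - \<pi> $ j)"
      using \<pi>_pos[of j] by (simp add: field_simps power2_eq_square)
    also have "\<dots> \<le> ((q - \<pi>) $ j)\<^sup>2 / c + (q $ j - \<pi> $ j)"
      using \<pi>(1)[of j] \<pi>(2) by (intro add_right_mono divide_left_mono) (auto intro: mult_pos_pos \<pi>_pos)
    finally show ?thesis .
  qed
  then have "kl_div q \<pi> \<le> (\<Sum>j\<in>UNIV. ((q - \<pi>) $ j)\<^sup>2 / c + (q $ j - \<pi> $ j))"
    unfolding kl_div_def by (rule sum_mono)
  also have "\<dots> = (\<Sum>j\<in>UNIV. ((q - \<pi>) $ j)\<^sup>2) / c"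
    using assms by (simp add: sum.distrib sum_subtractf sum_divide_distrib)
  also have "(\<Sum>j\<in>UNIV. ((q - \<pi>) $ j)\<^sup>2) = (norm (q - \<pi>))\<^sup>2"
    by (simp only: power2_norm_eq_inner inner_vec_def) (simp add: power2_eq_square)
  finally show ?thesis .
qed

lemma sum_newton_prob: "(\<Sum>j\<in>UNIV. newton_prob a \<theta> d i $ j) = 1"
  using sum_choice_prob_centred[of a i \<theta> d]
  by (simp add: newton_prob_eq choice_jac_mult sum.distrib sum_choice_prob)

text \<open>The mean attribute is a convex combination of the attributes.\<close>
lemma norm_centred_le_attr_diam:
  assumes "finite S" "i \<in> S"
  shows "norm (a i j - mean_attr a i \<theta>) \<le> attr_diam a S"
proof -
  have "a i j - mean_attr a i \<theta> = (\<Sum>k\<in>UNIV. choice_prob a i \<theta> $ k *\<^sub>R (a i j - a i k))"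
    unfolding scaleR_diff_right sum_subtractf
    by (simp add: mean_attr_def scaleR_left.sum[symmetric] sum_choice_prob)
  also have "norm \<dots> \<le> (\<Sum>k\<in>UNIV. choice_prob a i \<theta> $ k * attr_diam a S)"
  proof (rule order_trans[OF norm_sum sum_mono])
    fix k
    have "{norm (a i j - a i k) |i j k. i \<in> S} = (\<lambda>(i, j, k). norm (a i j - a i k)) ` (S \<times> UNIV \<times> UNIV)"
      by (auto simp: image_iff) blast
    then have "finite {norm (a i j - a i k) |i j k. i \<in> S}"
      using \<open>finite S\<close> by simp
    then have "norm (a i j - a i k) \<le> attr_diam a S"
      unfolding attr_diam_def using \<open>i \<in> S\<close> by (intro Max_ge) auto
    then show "norm (choice_prob a i \<theta> $ k *\<^sub>R (a i j - a i k)) \<le> choice_prob a i \<theta> $ k * attr_diam a S"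
      using choice_prob_pos[of a i \<theta> k] by simp
  qed
  also have "\<dots> = attr_diam a S"
    by (simp add: sum_distrib_right[symmetric] sum_choice_prob)
  finally show ?thesis .
qed

lemma newton_prob_nonneg:
  assumes "finite S" "i \<in> S" and small: "attr_diam a S * norm d \<le> 1"
  shows "0 \<le> newton_prob a \<theta> d i $ j"
proof -
  have "\<bar>(a i j - mean_attr a i \<theta>) \<bullet> d\<bar> \<le> norm (a i j - mean_attr a i \<theta>) * norm d"
    by (rule Cauchy_Schwarz_ineq2)
  also have "\<dots> \<le> attr_diam a S * norm d"
    by (intro mult_right_mono norm_centred_le_attr_diam assms) auto
  finally have "0 \<le> 1 + (a i j - mean_attr a i \<theta>) \<bullet> d"
    using small by linarith
  then show ?thesis
    using choice_prob_pos[of a i \<theta> j] by (simp add: newton_prob_def)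
qed

text \<open>
  In \<open>kl_div (q i) (\<pi> i)\<close> the logarithm of \<open>\<pi> i\<close> at \<open>\<theta>0\<close> is affine in the attributes, so only
  the mean attribute under \<open>q i\<close> matters. Stationarity of the Newton subproblem evaluates the sum of
  these means, and complementarity with the constraints active at \<open>\<theta>0\<close> turns the multiplier term
  into \<open>b \<bullet> \<mu>\<close>. The point \<open>\<theta>0\<close> need not be optimal for this identity.
\<close>
lemma newton_pair_gap_eq_kl_div:
  fixes A :: "real^'n^'m"
  assumes kkt: "newton_pair A b (loss a y S) \<theta> d \<mu>"
    and supp: "\<And>r. r \<notin> active_set A b \<theta>0 \<Longrightarrow> \<mu> $ r = 0"
    and q_nonneg: "\<And>i j. i \<in> S \<Longrightarrow> 0 \<le> newton_prob a \<theta> d i $ j"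
  shows "loss a y S \<theta>0 - (entropy S (newton_prob a \<theta> d) - b \<bullet> \<mu>) =
    (\<Sum>i\<in>S. kl_div (newton_prob a \<theta> d i) (choice_prob a i \<theta>0))"
proof -
  let ?q = "newton_prob a \<theta> d"
  let ?lse = "\<lambda>i. ln (\<Sum>l\<in>UNIV. exp (a i l \<bullet> \<theta>0))"
  define qbar where "qbar i = (\<Sum>j\<in>UNIV. ?q i $ j *\<^sub>R a i j)" for i
  have kl: "kl_div (?q i) (choice_prob a i \<theta>0) =
      (\<Sum>j\<in>UNIV. ?q i $ j * ln (?q i $ j)) + ?lse i - qbar i \<bullet> \<theta>0" if "i \<in> S" for i
  proof -
    have "?q i $ j * ln (?q i $ j / choice_prob a i \<theta>0 $ j) =
        ?q i $ j * ln (?q i $ j) - ?q i $ j * (a i j \<bullet> \<theta>0) + ?q i $ j * ?lse i" for j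
      using q_nonneg[OF that, of j] choice_prob_pos[of a i \<theta>0 j]
      by (cases "?q i $ j = 0") (auto simp: ln_div ln_choice_prob algebra_simps)
    then have "kl_div (?q i) (choice_prob a i \<theta>0) = (\<Sum>j\<in>UNIV. ?q i $ j * ln (?q i $ j))
        - (\<Sum>j\<in>UNIV. ?q i $ j * (a i j \<bullet> \<theta>0)) + (\<Sum>j\<in>UNIV. ?q i $ j) * ?lse i"
      unfolding kl_div_def sum_distrib_right by (simp add: sum.distrib sum_subtractf)
    then show ?thesis
      by (simp add: sum_newton_prob qbar_def inner_sum_left)
  qed
  have qbar: "qbar i = mean_attr a i \<theta> +
      (\<Sum>j\<in>UNIV. (choice_prob a i \<theta> $ j * ((a i j - mean_attr a i \<theta>) \<bullet> d)) *\<^sub>R a i j)" for i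
    by (simp add: qbar_def newton_prob_eq choice_jac_mult scaleR_add_left sum.distrib mean_attr_def)
  have "(\<Sum>i\<in>S. qbar i) = (\<Sum>i\<in>S. a i (y i)) +
      (gradient (loss a y S) \<theta> + hessian (loss a y S) \<theta> *v d)"
    by (simp add: qbar sum.distrib hessian_loss_mult gradient_loss sum_subtractf)
  also have "gradient (loss a y S) \<theta> + hessian (loss a y S) \<theta> *v d = - (transpose A *v \<mu>)"
    using kkt unfolding newton_pair_def by (simp add: eq_neg_iff_add_eq_0)
  finally have "(\<Sum>i\<in>S. qbar i \<bullet> \<theta>0) = (\<Sum>i\<in>S. a i (y i) \<bullet> \<theta>0) - (transpose A *v \<mu>) \<bullet> \<theta>0"
    by (simp add: inner_sum_left[symmetric] inner_diff_left)
  also have "(transpose A *v \<mu>) \<bullet> \<theta>0 = (A *v \<theta>0) \<bullet> \<mu>"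
    using inner_transpose_matrix[of \<theta>0 A \<mu>] by (simp only: inner_commute)
  also have "(A *v \<theta>0) \<bullet> \<mu> = b \<bullet> \<mu>"
    unfolding inner_vec_def using supp by (intro sum.cong) (auto simp: active_set_def)
  finally show ?thesis
    by (simp add: kl sum.distrib sum_subtractf loss_eq entropy_def)
qed

lemma leaf_cost_eq:
  fixes a :: "'i \<Rightarrow> 'j::finite option \<Rightarrow> real^'n"
  assumes "is_arg_min (loss a y S) (\<lambda>\<theta>. \<theta> \<in> \<Theta>) \<theta>0" "Nmin \<le> card S"
  shows "leaf_cost a y \<Theta> pen Nmin S = ereal (loss a y S \<theta>0 + pen * real CARD('n))"
proof -
  have "(INF \<theta>\<in>\<Theta>. ereal (loss a y S \<theta> + pen * real CARD('n))) = ereal (loss a y S \<theta>0 + pen * real CARD('n))"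
    using assms(1) by (intro antisym INF_lower INF_greatest) (auto simp: is_arg_min_linorder)
  then show ?thesis
    using assms(2) by (simp add: leaf_cost_def)
qed

section \<open>The error of one constrained Newton step\<close>

text \<open>
  Here \<open>\<delta>\<close> is the distance to the optimizer, \<open>D\<close> the length of the Newton step and \<open>e\<close> the
  discrepancy between the two, all in identified coordinates. With \<open>g = LG / m\<close>, passing from
  \<open>\<delta>\<^sup>2\<close> to \<open>D\<^sup>2\<close> costs the factor \<open>1 - g \<delta>\<close>. It costs at most
  \<open>g (Lp \<delta>) / 2 \<le> M g / 2\<close> in the first summand and half of \<open>2 M g\<close> in the second, and
  \<open>2 M g\<close> exceeds the required \<open>M g / 2\<close> by exactly the sum of the two.
\<close>
lemma newton_step_arithmetic:
  fixes m LG Lp M \<delta> e D \<nu>sq N :: real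
  assumes nonneg: "0 < m" "0 \<le> LG" "0 \<le> Lp" "0 \<le> M" "0 \<le> \<delta>"
    and e: "e \<le> LG / (2 * m) * \<delta>\<^sup>2" and D: "\<delta> - e \<le> D" and \<nu>: "m * D\<^sup>2 \<le> \<nu>sq"
    and N: "N \<le> Lp / 2 * \<delta>\<^sup>2 + M * e"
    and small: "LG * \<delta> \<le> m / 2" "Lp * \<delta> \<le> M"
  shows "N \<le> (Lp / (2 * m) + 2 * M * LG / m\<^sup>2) * \<nu>sq"
proof -
  define g where "g = LG / m"
  have g: "0 \<le> g" "g * \<delta> \<le> 1 / 2"
    using nonneg small(1) by (auto simp: g_def divide_le_eq)
  have e': "e \<le> g / 2 * \<delta>\<^sup>2"
    using e by (simp add: g_def)
  have "(1 - g * \<delta> / 2) * \<delta> \<le> D"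
    using e' D by (simp add: algebra_simps power2_eq_square)
  then have "((1 - g * \<delta> / 2) * \<delta>)\<^sup>2 \<le> D\<^sup>2"
    using g nonneg by (intro power_mono) auto
  moreover have "(1 - g * \<delta>) * \<delta>\<^sup>2 \<le> ((1 - g * \<delta> / 2) * \<delta>)\<^sup>2"
  proof -
    have "(1 - g * \<delta> / 2)\<^sup>2 = (1 - g * \<delta>) + (g * \<delta> / 2)\<^sup>2"
      by (simp add: power2_eq_square algebra_simps)
    then have "1 - g * \<delta> \<le> (1 - g * \<delta> / 2)\<^sup>2"
      by simp
    then show ?thesis
      unfolding power_mult_distrib by (rule mult_right_mono) simp
  qed
  ultimately have "m * ((1 - g * \<delta>) * \<delta>\<^sup>2) \<le> m * D\<^sup>2"
    using nonneg by (intro mult_left_mono) auto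
  with \<nu> have \<nu>': "m * ((1 - g * \<delta>) * \<delta>\<^sup>2) \<le> \<nu>sq"
    by simp
  have C: "(Lp / (2 * m) + 2 * M * LG / m\<^sup>2) * (m * ((1 - g * \<delta>) * \<delta>\<^sup>2))
      = (Lp / 2 + 2 * M * g) * (1 - g * \<delta>) * \<delta>\<^sup>2"
    using nonneg(1) by (simp add: g_def field_simps power2_eq_square)
  have "Lp / 2 + M * g / 2 \<le> (Lp / 2 + 2 * M * g) * (1 - g * \<delta>)"
  proof -
    have "g * (Lp * \<delta>) \<le> M * g"
      using mult_left_mono[OF small(2) g(1)] by (simp only: mult.commute)
    moreover have "(2 * M * g) * (g * \<delta>) \<le> M * g"
      using mult_left_mono[OF g(2), of "2 * M * g"] g(1) nonneg by simp
    moreover have "(Lp / 2 + 2 * M * g) * (1 - g * \<delta>) =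
        Lp / 2 + 2 * M * g - g * (Lp * \<delta>) / 2 - (2 * M * g) * (g * \<delta>)"
      by (simp add: field_simps)
    moreover have "0 \<le> M * g" using g nonneg by simp
    ultimately show ?thesis by linarith
  qed
  then have "(Lp / 2 + M * g / 2) * \<delta>\<^sup>2 \<le> (Lp / 2 + 2 * M * g) * (1 - g * \<delta>) * \<delta>\<^sup>2"
    by (intro mult_right_mono) auto
  moreover have "N \<le> (Lp / 2 + M * g / 2) * \<delta>\<^sup>2"
    using N mult_left_mono[OF e' nonneg(4)] by (simp add: algebra_simps)
  moreover have "(Lp / (2 * m) + 2 * M * LG / m\<^sup>2) * (m * ((1 - g * \<delta>) * \<delta>\<^sup>2)) \<le>
      (Lp / (2 * m) + 2 * M * LG / m\<^sup>2) * \<nu>sq"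
    using \<nu>' nonneg by (intro mult_left_mono) auto
  ultimately show ?thesis
    using C by linarith
qed

text \<open>
  Both bounds come from the Taylor remainders at \<open>\<theta>\<close> in direction \<open>\<theta>0 - \<theta>\<close>. The first one
  converts the distance to \<open>\<theta>0\<close> into the Newton decrement; the second one keeps the distance, and
  makes the lower bounds converge as the checkpoint approaches \<open>\<theta>0\<close>.
\<close>
lemma newton_prob_error:
  fixes A :: "real^'n^'m" and Z :: "real^'k^'n" and a :: "'i \<Rightarrow> 'j::finite option \<Rightarrow> real^'n"
    and S :: "'i set" and y :: "'i \<Rightarrow> 'j option"
  defines "G \<equiv> hessian (loss a y S)"
  assumes min: "is_arg_min (loss a y S) (\<lambda>\<theta>. \<theta> \<in> polyhedron_of A b) \<theta>0"
    and ortho: "transpose Z ** Z = mat 1" and Z: "span (columns Z) = ident_space a S A (active_set A b \<theta>0)"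
    and U: "U \<subseteq> active_face A b (active_set A b \<theta>0)" "convex U" "\<theta>0 \<in> U" "\<theta> \<in> U"
    and near: "0 < r" "\<And>h. h \<in> face_tangent A (active_set A b \<theta>0) \<Longrightarrow> norm h < r \<Longrightarrow> \<theta>0 + h \<in> U"
    and kkt: "newton_pair A b (loss a y S) \<theta> d \<mu>"
    and d: "d \<in> face_tangent A (active_set A b \<theta>0)"
    and supp: "\<And>r. r \<notin> active_set A b \<theta>0 \<Longrightarrow> \<mu> $ r = 0"
    and "i \<in> S"
    and m: "0 < m" "m \<le> lambda_min (transpose Z ** G \<theta> ** Z)"
    and LG: "0 \<le> LG" "\<And>z z'. z \<in> U \<Longrightarrow> z' \<in> U \<Longrightarrow>
      spec_norm (transpose Z ** (G z - G z') ** Z) \<le> LG * norm (z - z')"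
    and M: "0 \<le> M" "spec_norm (choice_jac a i \<theta> ** Z) \<le> M"
    and Lp: "0 \<le> Lp" "\<And>z z'. z \<in> U \<Longrightarrow> z' \<in> U \<Longrightarrow>
      spec_norm ((choice_jac a i z - choice_jac a i z') ** Z) \<le> Lp * norm (z - z')"
    and small: "LG * norm (\<theta> - \<theta>0) \<le> m / 2" "Lp * norm (\<theta> - \<theta>0) \<le> M"
  shows "norm (newton_prob a \<theta> d i - choice_prob a i \<theta>0)
      \<le> (Lp / (2 * m) + 2 * M * LG / m\<^sup>2) * (d \<bullet> (G \<theta> *v d))"
    and "norm (newton_prob a \<theta> d i - choice_prob a i \<theta>0)
      \<le> (Lp / 2 + M * (LG / (2 * m))) * (norm (\<theta> - \<theta>0))\<^sup>2"
proof -
  let ?R = "active_set A b \<theta>0" and ?g = "gradient (loss a y S)" and ?N = "choice_null a S"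
  let ?J = "choice_jac a i"
  have tangent: "Z *v u \<in> face_tangent A ?R" for u
    using matrix_vector_in_ident_space[OF Z] by (simp add: ident_space_def)
  have normZ: "norm (Z *v u) = norm u" for u
    by (rule norm_orthonormal_columns[OF ortho])
  have "\<theta>0 - \<theta> \<in> face_tangent A ?R"
    using U by (intro active_face_diff) auto
  then obtain \<kappa> u where \<kappa>: "\<kappa> \<in> ?N" and w: "\<theta>0 - \<theta> = \<kappa> + Z *v u" and u0: "norm u \<le> norm (\<theta>0 - \<theta>)"
    by (rule tangent_decomposition[OF ortho Z])
  have u_le: "norm u \<le> norm (\<theta> - \<theta>0)"
    using u0 by (subst norm_minus_commute)
  obtain \<kappa>' u' where \<kappa>': "\<kappa>' \<in> ?N" and d_eq: "d = \<kappa>' + Z *v u'"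
    using tangent_decomposition[OF ortho Z d] by blast
  have scale: "s *\<^sub>R \<kappa> \<in> ?N" for s
    using \<kappa> by (rule subspace_scale[OF subspace_choice_null])
  define r' where "r' = r / (norm u + 1)"
  have r': "0 < r'"
    unfolding r'_def using near(1) by (intro divide_pos_pos) (auto intro: add_nonneg_pos)
  have near': "\<theta>0 + c *\<^sub>R (Z *v u) \<in> U" if "\<bar>c\<bar> < r'" for c
  proof (rule near(2))
    show "c *\<^sub>R (Z *v u) \<in> face_tangent A ?R"
      by (rule subspace_scale[OF subspace_face_tangent tangent])
    have "\<bar>c\<bar> * (norm u + 1) < r"
      using that unfolding r'_def by (simp add: pos_less_divide_eq add_nonneg_pos)
    then show "norm (c *\<^sub>R (Z *v u)) < r"
      by (simp add: normZ algebra_simps)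
  qed

  have prob: "norm (choice_prob a i \<theta>0 - choice_prob a i \<theta> - ?J \<theta> *v (\<theta>0 - \<theta>)) \<le> Lp / 2 * (norm u)\<^sup>2"
  proof -
    have "norm (choice_prob a i \<theta>0 - choice_prob a i \<theta> - ?J \<theta> *v (\<theta>0 - \<theta>)) \<le> Lp / 2 * (norm (Z *v u))\<^sup>2"
    proof (rule quadratic_remainder_modulo_invariant[OF has_derivative_choice_prob U(2) U(4) U(3) w _ _ r' near' _ Lp(1)])
      show "(*v) (?J (z + s *\<^sub>R \<kappa>)) = (*v) (?J z)" for z s
        by (simp add: choice_jac_add_null[OF scale \<open>i \<in> S\<close>])
      show "?J z *v \<kappa> = 0" for z
        by (rule choice_jac_mult_null[OF \<kappa> \<open>i \<in> S\<close>])
      fix z z' assume z: "z \<in> U" "z' \<in> U"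
      have "?J z *v (Z *v u) - ?J z' *v (Z *v u) = ((?J z - ?J z') ** Z) *v u"
        by (simp add: matrix_vector_mul_assoc[symmetric] matrix_vector_mult_diff_rdistrib)
      also have "norm \<dots> \<le> spec_norm ((?J z - ?J z') ** Z) * norm u"
        by (rule norm_matrix_vector_le_spec_norm)
      also have "\<dots> \<le> Lp * norm (z - z') * norm u"
        using Lp(2)[OF z] by (rule mult_right_mono) simp
      finally show "norm (?J z *v (Z *v u) - ?J z' *v (Z *v u)) \<le> Lp * norm (z - z') * norm (Z *v u)"
        by (simp add: normZ)
    qed
    then show ?thesis by (simp add: normZ)
  qed

  define \<Phi> where "\<Phi> z = transpose Z *v ?g z" for z
  define \<Phi>' where "\<Phi>' z h = transpose Z *v (G z *v h)" for z h
  have grad: "norm (\<Phi> \<theta>0 - \<Phi> \<theta> - \<Phi>' \<theta> (\<theta>0 - \<theta>)) \<le> LG / 2 * (norm u)\<^sup>2"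
  proof -
    have "norm (\<Phi> \<theta>0 - \<Phi> \<theta> - \<Phi>' \<theta> (\<theta>0 - \<theta>)) \<le> LG / 2 * (norm (Z *v u))\<^sup>2"
    proof (rule quadratic_remainder_modulo_invariant[OF _ U(2) U(4) U(3) w _ _ r' near' _ LG(1)])
      show "(\<Phi> has_derivative \<Phi>' z) (at z)" for z
        unfolding \<Phi>_def \<Phi>'_def G_def
        by (rule bounded_linear.has_derivative[OF matrix_vector_mul_bounded_linear has_derivative_gradient])
      show "\<Phi>' (z + s *\<^sub>R \<kappa>) = \<Phi>' z" for z s
        by (simp add: \<Phi>'_def G_def hessian_add_null[OF scale] fun_eq_iff)
      show "\<Phi>' z \<kappa> = 0" for z
        by (simp add: \<Phi>'_def G_def hessian_mult_null[OF \<kappa>])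
      fix z z' assume z: "z \<in> U" "z' \<in> U"
      have "\<Phi>' z (Z *v u) - \<Phi>' z' (Z *v u) = (transpose Z ** (G z - G z') ** Z) *v u"
        by (simp add: \<Phi>'_def matrix_vector_mul_assoc[symmetric] matrix_vector_mult_diff_rdistrib
            matrix_vector_mult_diff_distrib del: transpose_matrix_vector)
      also have "norm \<dots> \<le> spec_norm (transpose Z ** (G z - G z') ** Z) * norm u"
        by (rule norm_matrix_vector_le_spec_norm)
      also have "\<dots> \<le> LG * norm (z - z') * norm u"
        using LG(2)[OF z] by (rule mult_right_mono) simp
      finally show "norm (\<Phi>' z (Z *v u) - \<Phi>' z' (Z *v u)) \<le> LG * norm (z - z') * norm (Z *v u)"
        by (simp add: normZ)
    qed
    then show ?thesis by (simp add: normZ)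
  qed
  \<comment> \<open>The reduced gradient vanishes at the optimizer.\<close>
  have "x \<bullet> \<Phi> \<theta>0 = 0" for x
    unfolding \<Phi>_def inner_transpose_matrix
    using gradient_orthogonal_tangent[OF min tangent, of x] by (simp add: inner_commute)
  then have stat0: "\<Phi> \<theta>0 = 0"
    using inner_eq_zero_iff by blast
  \<comment> \<open>The linearised reduced gradient vanishes at the end of the step: multipliers and tangent
    vectors have disjoint supports in the constraint space.\<close>
  have "x \<bullet> (\<Phi> \<theta> + \<Phi>' \<theta> d) = 0" for x
  proof -
    have "?g \<theta> + G \<theta> *v d = - (transpose A *v \<mu>)"
      using kkt unfolding newton_pair_def G_def by (simp add: eq_neg_iff_add_eq_0)
    then have "x \<bullet> (\<Phi> \<theta> + \<Phi>' \<theta> d) = - ((Z *v x) \<bullet> (transpose A *v \<mu>))"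
      unfolding \<Phi>_def \<Phi>'_def matrix_vector_right_distrib[symmetric] inner_transpose_matrix
      by (simp add: inner_transpose_matrix del: transpose_matrix_vector)
    also have "(Z *v x) \<bullet> (transpose A *v \<mu>) = (A *v (Z *v x)) \<bullet> \<mu>"
      by (rule inner_transpose_matrix)
    also have "\<dots> = 0"
      unfolding inner_vec_def using tangent[of x] supp
      by (intro sum.neutral) (auto simp: face_tangent_def)
    finally show ?thesis by simp
  qed
  then have stat: "\<Phi> \<theta> + \<Phi>' \<theta> d = 0"
    using inner_eq_zero_iff by blast

  define e where "e = u' - u"
  have dw: "d - (\<theta>0 - \<theta>) = (\<kappa>' - \<kappa>) + Z *v e"
    by (simp add: d_eq w e_def matrix_vector_mult_diff_distrib)
  have diff_null: "\<kappa>' - \<kappa> \<in> ?N"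
    using \<kappa> \<kappa>' by (intro subspace_diff[OF subspace_choice_null])
  have "(transpose Z ** G \<theta> ** Z) *v e = \<Phi>' \<theta> (d - (\<theta>0 - \<theta>))"
    unfolding dw \<Phi>'_def G_def
    by (simp add: matrix_vector_right_distrib hessian_mult_null[OF diff_null]
        matrix_vector_mul_assoc[symmetric] del: transpose_matrix_vector)
  also have "\<dots> = \<Phi>' \<theta> d - \<Phi>' \<theta> (\<theta>0 - \<theta>)"
    by (simp add: \<Phi>'_def matrix_vector_mult_diff_distrib del: transpose_matrix_vector)
  also have "\<dots> = \<Phi> \<theta>0 - \<Phi> \<theta> - \<Phi>' \<theta> (\<theta>0 - \<theta>)"
    using stat stat0 by (simp add: add_eq_0_iff2)
  finally have residual: "norm ((transpose Z ** G \<theta> ** Z) *v e) \<le> LG / 2 * (norm u)\<^sup>2"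
    using grad by simp
  have sym: "x \<bullet> ((transpose Z ** G \<theta> ** Z) *v x') = x' \<bullet> ((transpose Z ** G \<theta> ** Z) *v x)" for x x'
    unfolding reduced_hessian_form G_def by (rule hessian_sym)
  have ray: "m * (norm x)\<^sup>2 \<le> x \<bullet> ((transpose Z ** G \<theta> ** Z) *v x)" for x
  proof -
    have "m * (norm x)\<^sup>2 \<le> lambda_min (transpose Z ** G \<theta> ** Z) * (norm x)\<^sup>2"
      using m(2) by (rule mult_right_mono) simp
    also have "\<dots> \<le> x \<bullet> ((transpose Z ** G \<theta> ** Z) *v x)"
      by (rule lambda_min_rayleigh[OF sym])
    finally show ?thesis .
  qed
  have e_le: "norm e \<le> LG / (2 * m) * (norm u)\<^sup>2"
  proof (cases "e = 0")
    case True
    then show ?thesis using m LG by simp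
  next
    case False
    have "m * (norm e)\<^sup>2 \<le> norm e * (LG / 2 * (norm u)\<^sup>2)"
      using ray[of e] norm_cauchy_schwarz[of e "(transpose Z ** G \<theta> ** Z) *v e"]
        mult_left_mono[OF residual, of "norm e"] by simp
    then have "m * norm e \<le> LG / 2 * (norm u)\<^sup>2"
      using False by (simp add: power2_eq_square mult_ac)
    then show ?thesis
      using m(1) by (simp add: field_simps)
  qed
  have u'_ge: "norm u - norm e \<le> norm u'"
    unfolding e_def by norm
  have \<nu>: "m * (norm u')\<^sup>2 \<le> d \<bullet> (G \<theta> *v d)"
  proof -
    have "d \<bullet> (G \<theta> *v d) = (Z *v u') \<bullet> (G \<theta> *v (Z *v u'))"
      using hessian_mult_null[OF \<kappa>'] hessian_sym[of \<kappa>' a y S \<theta> "Z *v u'"]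
      by (simp add: d_eq G_def matrix_vector_right_distrib inner_add_left)
    then show ?thesis
      using ray[of u'] by (simp add: reduced_hessian_form)
  qed
  have err: "norm (newton_prob a \<theta> d i - choice_prob a i \<theta>0) \<le> Lp / 2 * (norm u)\<^sup>2 + M * norm e"
  proof -
    have split: "newton_prob a \<theta> d i - choice_prob a i \<theta>0 =
      ?J \<theta> *v (d - (\<theta>0 - \<theta>)) - (choice_prob a i \<theta>0 - choice_prob a i \<theta> - ?J \<theta> *v (\<theta>0 - \<theta>))"
      by (simp add: newton_prob_eq matrix_vector_mult_diff_distrib)
    have "?J \<theta> *v (d - (\<theta>0 - \<theta>)) = (?J \<theta> ** Z) *v e"
      unfolding dw by (simp add: matrix_vector_right_distrib choice_jac_mult_null[OF diff_null \<open>i \<in> S\<close>]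
          matrix_vector_mul_assoc)
    then have "norm (newton_prob a \<theta> d i - choice_prob a i \<theta>0) \<le> norm ((?J \<theta> ** Z) *v e) +
        norm (choice_prob a i \<theta>0 - choice_prob a i \<theta> - ?J \<theta> *v (\<theta>0 - \<theta>))"
      unfolding split by (simp only: norm_triangle_ineq4)
    moreover have "norm ((?J \<theta> ** Z) *v e) \<le> M * norm e"
      using norm_matrix_vector_le_spec_norm[of "?J \<theta> ** Z" e] mult_right_mono[OF M(2), of "norm e"] by simp
    ultimately show ?thesis
      using prob by linarith
  qed
  show "norm (newton_prob a \<theta> d i - choice_prob a i \<theta>0)
      \<le> (Lp / (2 * m) + 2 * M * LG / m\<^sup>2) * (d \<bullet> (G \<theta> *v d))"
  proof (rule newton_step_arithmetic[OF m(1) LG(1) Lp(1) M(1) norm_ge_zero e_le u'_ge \<nu> err])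
    show "LG * norm u \<le> m / 2"
      using small(1) mult_left_mono[OF u_le LG(1)] by linarith
    show "Lp * norm u \<le> M"
      using small(2) mult_left_mono[OF u_le Lp(1)] by linarith
  qed
  have "norm (newton_prob a \<theta> d i - choice_prob a i \<theta>0) \<le> (Lp / 2 + M * (LG / (2 * m))) * (norm u)\<^sup>2"
    using err mult_left_mono[OF e_le M(1)] by (simp add: algebra_simps)
  also have "\<dots> \<le> (Lp / 2 + M * (LG / (2 * m))) * (norm (\<theta> - \<theta>0))\<^sup>2"
    using u_le Lp(1) LG(1) M(1) m(1) by (intro mult_left_mono power_mono) auto
  finally show "norm (newton_prob a \<theta> d i - choice_prob a i \<theta>0)
      \<le> (Lp / 2 + M * (LG / (2 * m))) * (norm (\<theta> - \<theta>0))\<^sup>2" .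
qed

section \<open>The local constants\<close>

text \<open>
  The bound by \<open>K\<close> makes the set of quotients bounded, and the two points make it nonempty; without
  either, its supremum would be an arbitrary real number.
\<close>
lemma Sup_difference_quotient:
  fixes g :: "'a::real_normed_vector \<Rightarrow> 'a \<Rightarrow> real"
  assumes le: "\<And>z z'. g z z' \<le> K * norm (z - z')" and nonneg: "\<And>z z'. 0 \<le> g z z'"
    and pq: "p0 \<in> U" "p1 \<in> U" "p0 \<noteq> p1"
  defines "Q \<equiv> Sup {g z z' / norm (z - z') | z z'. z \<in> U \<and> z' \<in> U \<and> z \<noteq> z'}"
  shows "0 \<le> Q" and "Q \<le> K" and "z \<in> U \<Longrightarrow> z' \<in> U \<Longrightarrow> g z z' \<le> Q * norm (z - z')"
proof -
  let ?X = "{g z z' / norm (z - z') | z z'. z \<in> U \<and> z' \<in> U \<and> z \<noteq> z'}"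
  have bound: "x \<le> K" if "x \<in> ?X" for x
    using that le by (auto simp: divide_le_eq)
  then have bdd: "bdd_above ?X"
    by (rule bdd_aboveI)
  have elem: "g z z' / norm (z - z') \<le> Q" if "z \<in> U" "z' \<in> U" "z \<noteq> z'" for z z'
    unfolding Q_def using that by (intro cSup_upper bdd) auto
  show "0 \<le> Q"
    using order_trans[OF divide_nonneg_nonneg[OF nonneg norm_ge_zero] elem[OF pq]] .
  show "Q \<le> K"
    unfolding Q_def using pq by (intro cSup_least bound) auto
  show "g z z' \<le> Q * norm (z - z')" if "z \<in> U" "z' \<in> U"
  proof (cases "z = z'")
    case True
    then show ?thesis using le[of z z'] by simp
  next
    case False
    then show ?thesis using elem[OF that False] by (simp add: divide_le_eq)
  qed
qed

text \<open>The bound \<open>C\<close> is independent of \<open>U\<close>, so the neighbourhood can be chosen in terms of it.\<close>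
lemma LG_const_bounds:
  fixes a :: "'i \<Rightarrow> 'j::finite option \<Rightarrow> real^'n" and Z :: "real^'k^'n"
  obtains C where "0 \<le> C"
    and "\<And>U p0 p1. p0 \<in> U \<Longrightarrow> p1 \<in> U \<Longrightarrow> p0 \<noteq> p1 \<Longrightarrow>
      0 \<le> LG_const (hessian (loss a y S)) Z U \<and> LG_const (hessian (loss a y S)) Z U \<le> C \<and>
      (\<forall>z\<in>U. \<forall>z'\<in>U. spec_norm (transpose Z ** (hessian (loss a y S) z - hessian (loss a y S) z') ** Z)
        \<le> LG_const (hessian (loss a y S)) Z U * norm (z - z'))"
proof -
  obtain C where C: "\<And>z z'. spec_norm (transpose Z ** (hessian (loss a y S) z - hessian (loss a y S) z') ** Z)
        \<le> C * norm (z - z')" "0 \<le> C"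
    using hessian_lipschitz by blast
  show ?thesis
  proof (rule that[OF C(2)])
    fix U p0 p1 assume pq: "p0 \<in> U" "p1 \<in> U" "p0 \<noteq> (p1 :: real^'n)"
    note Q = Sup_difference_quotient[OF C(1) spec_norm_nonneg pq, folded LG_const_def]
    show "0 \<le> LG_const (hessian (loss a y S)) Z U \<and> LG_const (hessian (loss a y S)) Z U \<le> C \<and>
      (\<forall>z\<in>U. \<forall>z'\<in>U. spec_norm (transpose Z ** (hessian (loss a y S) z - hessian (loss a y S) z') ** Z)
        \<le> LG_const (hessian (loss a y S)) Z U * norm (z - z'))"
      by (intro conjI ballI Q)
  qed
qed

lemma Lpi_const_bounds:
  fixes a :: "'i \<Rightarrow> 'j::finite option \<Rightarrow> real^'n" and Z :: "real^'k^'n"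
  assumes "finite S" "S \<noteq> {}"
  obtains C where "0 \<le> C"
    and "\<And>U p0 p1. p0 \<in> U \<Longrightarrow> p1 \<in> U \<Longrightarrow> p0 \<noteq> p1 \<Longrightarrow>
      0 \<le> Lpi_const a S Z U \<and> Lpi_const a S Z U \<le> C \<and>
      (\<forall>i\<in>S. \<forall>z\<in>U. \<forall>z'\<in>U. spec_norm ((choice_jac a i z - choice_jac a i z') ** Z)
        \<le> Lpi_const a S Z U * norm (z - z'))"
proof -
  have "\<exists>C. 0 \<le> C \<and> (\<forall>z z'. spec_norm ((choice_jac a i z - choice_jac a i z') ** Z) \<le> C * norm (z - z'))" for i
    by (rule choice_jac_lipschitz[of a i Z]) blast
  then have "\<exists>C. \<forall>i. 0 \<le> C i \<and>
      (\<forall>z z'. spec_norm ((choice_jac a i z - choice_jac a i z') ** Z) \<le> C i * norm (z - z'))"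
    by (intro choice allI)
  then obtain C where C: "\<And>i. 0 \<le> C i"
    "\<And>i z z'. spec_norm ((choice_jac a i z - choice_jac a i z') ** Z) \<le> C i * norm (z - z')"
    by blast
  show ?thesis
  proof (rule that)
    show "0 \<le> (\<Sum>i\<in>S. C i)"
      using C(1) by (rule sum_nonneg)
    fix U p0 p1 assume pq: "p0 \<in> U" "p1 \<in> U" "p0 \<noteq> (p1 :: real^'n)"
    let ?Q = "\<lambda>i. Sup {spec_norm ((choice_jac a i z - choice_jac a i z') ** Z) / norm (z - z') | z z'.
                   z \<in> U \<and> z' \<in> U \<and> z \<noteq> z'}"
    note Q = Sup_difference_quotient[OF C(2) spec_norm_nonneg pq]
    have Max: "Lpi_const a S Z U = Max (?Q ` S)"
      by (simp add: Lpi_const_def)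
    have upper: "?Q i \<le> Lpi_const a S Z U" if "i \<in> S" for i
      unfolding Max using that assms by (intro Max_ge) auto
    have "?Q i \<le> (\<Sum>i\<in>S. C i)" if "i \<in> S" for i
      by (rule order_trans[OF Q(2) member_le_sum[OF that C(1) assms(1)]])
    then have "Lpi_const a S Z U \<le> (\<Sum>i\<in>S. C i)"
      unfolding Max using assms by (intro Max.boundedI) auto
    moreover have "0 \<le> Lpi_const a S Z U"
    proof -
      obtain i where "i \<in> S" using assms(2) by blast
      then show ?thesis by (rule order_trans[OF Q(1) upper])
    qed
    moreover have "spec_norm ((choice_jac a i z - choice_jac a i z') ** Z) \<le> Lpi_const a S Z U * norm (z - z')"
      if "i \<in> S" "z \<in> U" "z' \<in> U" for i z z'
      using Q(3)[OF that(2,3), of i] mult_right_mono[OF upper[OF that(1)] norm_ge_zero[of "z - z'"]]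
      by linarith
    ultimately show "0 \<le> Lpi_const a S Z U \<and> Lpi_const a S Z U \<le> (\<Sum>i\<in>S. C i) \<and>
      (\<forall>i\<in>S. \<forall>z\<in>U. \<forall>z'\<in>U. spec_norm ((choice_jac a i z - choice_jac a i z') ** Z)
        \<le> Lpi_const a S Z U * norm (z - z'))"
      by (intro conjI ballI)
  qed
qed

lemma spec_norm_choice_jac_le_Mpi_const:
  assumes "finite S" "i \<in> S" "\<theta> \<in> U"
  shows "spec_norm (choice_jac a i \<theta> ** Z) \<le> Mpi_const a S Z U"
proof -
  obtain C where C: "\<And>\<theta>. spec_norm (choice_jac a i \<theta> ** Z) \<le> C"
    by (rule choice_jac_lipschitz[of a i Z]) (rule that)
  have "spec_norm (choice_jac a i \<theta> ** Z) \<le> (SUP \<theta>\<in>U. spec_norm (choice_jac a i \<theta> ** Z))"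
    by (rule cSUP_upper[OF assms(3) bdd_aboveI2[OF C]])
  also have "\<dots> \<le> Mpi_const a S Z U"
    unfolding Mpi_const_def by (rule Max_ge[OF finite_imageI[OF assms(1)] imageI[OF assms(2)]])
  finally show ?thesis .
qed

text \<open>
  If no probability moved in an identified direction, neither would the gradient of the loss,
  contradicting definiteness of the reduced Hessian.
\<close>
lemma choice_jac_nonzero:
  fixes Z :: "real^'k^'n"
  assumes "finite S" and "\<And>i. a i None = 0" and "transpose Z ** Z = mat 1"
    and "span (columns Z) = ident_space a S A R"
  obtains i where "i \<in> S" and "0 < spec_norm (choice_jac a i \<theta> ** Z)"
proof -
  have "\<exists>i\<in>S. 0 < spec_norm (choice_jac a i \<theta> ** Z)"
  proof (rule ccontr)
    assume "\<not> ?thesis"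
    then have zero: "spec_norm (choice_jac a i \<theta> ** Z) = 0" if "i \<in> S" for i
      using that spec_norm_nonneg by (metis order.order_iff_strict)
    \<comment> \<open>Observed choices enter the loss through a linear term, so the constant choice of the outside
      option gives the same Hessian.\<close>
    let ?M = "transpose Z ** hessian (loss a (\<lambda>_. None) S) \<theta> ** Z"
    obtain v where v: "norm v = 1" "lambda_min ?M = v \<bullet> (?M *v v)"
      by (rule lambda_min_rayleigh[of ?M]) (auto simp: reduced_hessian_form intro: hessian_sym)
    have jac: "choice_jac a i \<theta> *v (Z *v v) = 0" if "i \<in> S" for i
      using norm_matrix_vector_le_spec_norm[of "choice_jac a i \<theta> ** Z" v] zero[OF that]
      by (simp add: matrix_vector_mul_assoc)
    have "choice_prob a i \<theta> $ j * ((a i j - mean_attr a i \<theta>) \<bullet> (Z *v v)) = 0" if "i \<in> S" for i j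
      using arg_cong[OF jac[OF that], of "\<lambda>x. x $ j"]
      by (simp only: choice_jac_mult vec_lambda_beta zero_index)
    then have "hessian (loss a (\<lambda>_. None) S) \<theta> *v (Z *v v) = 0"
      unfolding hessian_loss_mult by (intro sum.neutral ballI) (simp only: scaleR_zero_left)
    then have "lambda_min ?M = 0"
      by (simp add: v(2) reduced_hessian_form)
    then show False
      using lambda_min_reduced_hessian_pos[of S a Z A R "\<lambda>_. None" \<theta>] assms by simp
  qed
  then show ?thesis using that by blast
qed

lemma pi_min_bounds:
  fixes a :: "'i \<Rightarrow> 'j::finite option \<Rightarrow> real^'n"
  assumes "finite S" "S \<noteq> {}"
  shows "0 < pi_min a S \<theta>" and "i \<in> S \<Longrightarrow> pi_min a S \<theta> \<le> choice_prob a i \<theta> $ j"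
proof -
  let ?X = "{choice_prob a i \<theta> $ j | i j. i \<in> S}"
  have "?X \<subseteq> (\<lambda>(i, j). choice_prob a i \<theta> $ j) ` (S \<times> UNIV)"
    by auto
  then have fin: "finite ?X"
    by (rule finite_subset) (simp add: assms(1))
  have ne: "?X \<noteq> {}"
    using assms(2) by auto
  show "0 < pi_min a S \<theta>"
    unfolding pi_min_def using fin ne by (subst Min_gr_iff) (auto simp: choice_prob_pos)
  show "i \<in> S \<Longrightarrow> pi_min a S \<theta> \<le> choice_prob a i \<theta> $ j"
    unfolding pi_min_def using fin by (intro Min_le) auto
qed

lemma sum_kl_div_le:
  fixes a :: "'i \<Rightarrow> 'j::finite option \<Rightarrow> real^'n"
  assumes "finite S" "S \<noteq> {}"
    and q: "\<And>i j. i \<in> S \<Longrightarrow> 0 \<le> q i $ j" "\<And>i. i \<in> S \<Longrightarrow> (\<Sum>j\<in>UNIV. q i $ j) = 1"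
    and close: "\<And>i. i \<in> S \<Longrightarrow> norm (q i - choice_prob a i \<theta>) \<le> \<eta>"
  shows "(\<Sum>i\<in>S. kl_div (q i) (choice_prob a i \<theta>)) \<le> real (card S) * \<eta>\<^sup>2 / pi_min a S \<theta>"
proof -
  have "kl_div (q i) (choice_prob a i \<theta>) \<le> \<eta>\<^sup>2 / pi_min a S \<theta>" if i: "i \<in> S" for i
  proof -
    have "kl_div (q i) (choice_prob a i \<theta>) \<le> (norm (q i - choice_prob a i \<theta>))\<^sup>2 / pi_min a S \<theta>"
      using q i pi_min_bounds[OF assms(1,2)] by (intro kl_div_le_chi_square) (auto simp: sum_choice_prob)
    also have "\<dots> \<le> \<eta>\<^sup>2 / pi_min a S \<theta>"
      using close[OF i] pi_min_bounds(1)[OF assms(1,2), of a \<theta>]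
      by (intro divide_right_mono power_mono) auto
    finally show ?thesis .
  qed
  then have "(\<Sum>i\<in>S. kl_div (q i) (choice_prob a i \<theta>)) \<le> (\<Sum>i\<in>S. \<eta>\<^sup>2 / pi_min a S \<theta>)"
    by (rule sum_mono)
  then show ?thesis by simp
qed

section \<open>The local estimates for constrained Newton checkpoints\<close>

theorem proposition2:
  fixes lab :: "'n::finite \<Rightarrow> ('j::finite, 'f) coord" and F :: "'f set"
    and I S :: "'i set" and x :: "'i \<Rightarrow> 'f \<Rightarrow> real" and p :: "'i \<Rightarrow> real^'j" and y :: "'i \<Rightarrow> 'j option"
    and A :: "real^'n^'m::finite" and b :: "real^'m" and \<gamma>low pen :: real and Nmin :: nat
    and a :: "'i \<Rightarrow> 'j option \<Rightarrow> real^'n" and L :: "real^'n \<Rightarrow> real" and G :: "real^'n \<Rightarrow> real^'n^'n"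
    and \<theta>opt :: "real^'n" and Istar :: "'m set" and Z :: "real^'k::finite^'n"
    and T :: "'t set" and \<theta> d :: "'t \<Rightarrow> real^'n" and \<mu> :: "'t \<Rightarrow> real^'m"
  assumes "finite F" and "coord_labelling lab F"
    and "finite I" and "S \<subseteq> I" and "\<forall>i\<in>I. 0 \<le> p i"
    and "a = attr_vec lab x p" and "L = loss a y S" and "G = hessian L"
    and "polyhedron_of A b \<noteq> {}"
    and "\<gamma>low > 0"
    and "\<forall>n j. lab n = Gamma j \<longrightarrow> (\<exists>r. row r A = - axis n 1 \<and> b $ r = - \<gamma>low)"
    and "pen \<ge> 0" and "Nmin \<ge> 1" and "card S \<ge> Nmin"
    and "is_arg_min L (\<lambda>\<theta>. \<theta> \<in> polyhedron_of A b) \<theta>opt"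
    and "Istar = active_set A b \<theta>opt"
    and "\<forall>t\<in>T. \<theta> t \<in> polyhedron_of A b \<and> newton_pair A b L (\<theta> t) (d t) (\<mu> t)"
    and "locally_stable A b \<theta>opt T \<theta> d \<mu>"
    and "ident_space a S A Istar \<noteq> {0}"
    and "transpose Z ** Z = mat 1" and "span (columns Z) = ident_space a S A Istar"
  shows "\<exists>W. nhd_within (active_face A b Istar) \<theta>opt W \<and>
    (\<forall>U. nhd_within (active_face A b Istar) \<theta>opt U \<and> convex U \<and> U \<subseteq> W \<and>
         (\<forall>t\<in>T. \<theta> t \<in> U \<longrightarrow> attr_diam a S * norm (d t) \<le> 1) \<longrightarrow>
      (let m = m_const G Z U;
           C = Lpi_const a S Z U / (2 * m) + 2 * Mpi_const a S Z U * LG_const G Z U / m\<^sup>2;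
           \<nu>sq = (\<lambda>t. d t \<bullet> (G (\<theta> t) *v d t));
           q = (\<lambda>t. newton_prob a (\<theta> t) (d t));
           H = leaf_cost a y (polyhedron_of A b) pen Nmin S;
           LB = (\<lambda>t. lower_bound a b pen S (\<theta> t) (d t) (\<mu> t))
       in m > 0 \<and>
          (\<forall>t\<in>T. \<theta> t \<in> U \<longrightarrow>
             (MAX i\<in>S. norm (q t i - choice_prob a i \<theta>opt)) \<le> C * \<nu>sq t \<and>
             0 \<le> H - ereal (LB t) \<and>
             H - ereal (LB t) = ereal (\<Sum>i\<in>S. kl_div (q t i) (choice_prob a i \<theta>opt)) \<and>
             (\<Sum>i\<in>S. kl_div (q t i) (choice_prob a i \<theta>opt))
               \<le> real (card S) * C\<^sup>2 / pi_min a S \<theta>opt * (\<nu>sq t)\<^sup>2) \<and>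
          ((\<lambda>t. ereal (LB t)) \<longlongrightarrow> H)
            (inf (filtercomap \<theta> (nhds \<theta>opt)) (principal {t\<in>T. \<theta> t \<in> U}))))"
proof -
  have fin: "finite S"
    using \<open>finite I\<close> \<open>S \<subseteq> I\<close> by (rule finite_subset[rotated])
  have ne: "S \<noteq> {}"
    using \<open>Nmin \<ge> 1\<close> \<open>card S \<ge> Nmin\<close> by auto
  have outside: "a i None = 0" for i
    by (simp add: \<open>a = attr_vec lab x p\<close> attr_vec_def)
  note L_def = \<open>L = loss a y S\<close> and G_def = \<open>G = hessian L\<close> and Istar_def = \<open>Istar = active_set A b \<theta>opt\<close>
  note ortho = \<open>transpose Z ** Z = mat 1\<close>
  have Z: "span (columns Z) = ident_space a S A (active_set A b \<theta>opt)"
    using \<open>span (columns Z) = ident_space a S A Istar\<close> by (simp only: Istar_def)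
  have min: "is_arg_min (loss a y S) (\<lambda>\<theta>. \<theta> \<in> polyhedron_of A b) \<theta>opt"
    using \<open>is_arg_min L _ \<theta>opt\<close> by (simp only: L_def)
  have feas: "\<theta>opt \<in> polyhedron_of A b"
    using min by (simp add: is_arg_min_def)
  have face: "\<theta>opt \<in> active_face A b Istar"
    using feas by (simp add: active_face_def Istar_def active_set_def)

  obtain \<epsilon>1 where \<epsilon>1: "0 < \<epsilon>1" and stable: "\<And>t. t \<in> T \<Longrightarrow> \<theta> t \<in> active_face A b Istar \<Longrightarrow>
      dist (\<theta> t) \<theta>opt < \<epsilon>1 \<Longrightarrow> d t \<in> face_tangent A Istar \<and> (\<forall>r. r \<notin> active_set A b \<theta>opt \<longrightarrow> \<mu> t $ r = 0)"
    using \<open>locally_stable A b \<theta>opt T \<theta> d \<mu>\<close> unfolding locally_stable_def face_tangent_def Istar_def by blast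
  obtain \<epsilon>2 m0 where \<epsilon>2: "0 < \<epsilon>2" and m0: "0 < m0"
    and eig: "\<And>z. norm (z - \<theta>opt) < \<epsilon>2 \<Longrightarrow> m0 \<le> lambda_min (transpose Z ** G z ** Z)"
    unfolding G_def L_def
    by (rule lambda_min_reduced_hessian_locally_bounded[OF fin outside ortho Z, where y = y and ?\<theta>0.0 = \<theta>opt])
      blast
  obtain CG where CG: "0 \<le> CG"
    and LG: "\<And>U p0 p1. p0 \<in> U \<Longrightarrow> p1 \<in> U \<Longrightarrow> p0 \<noteq> p1 \<Longrightarrow>
      0 \<le> LG_const G Z U \<and> LG_const G Z U \<le> CG \<and>
      (\<forall>z\<in>U. \<forall>z'\<in>U. spec_norm (transpose Z ** (G z - G z') ** Z) \<le> LG_const G Z U * norm (z - z'))"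
    unfolding G_def L_def by (rule LG_const_bounds[of a y S Z]) blast
  obtain Cp where Cp: "0 \<le> Cp"
    and Lp: "\<And>U p0 p1. p0 \<in> U \<Longrightarrow> p1 \<in> U \<Longrightarrow> p0 \<noteq> p1 \<Longrightarrow>
      0 \<le> Lpi_const a S Z U \<and> Lpi_const a S Z U \<le> Cp \<and>
      (\<forall>i\<in>S. \<forall>z\<in>U. \<forall>z'\<in>U. spec_norm ((choice_jac a i z - choice_jac a i z') ** Z)
        \<le> Lpi_const a S Z U * norm (z - z'))"
    by (rule Lpi_const_bounds[OF fin ne, of a Z]) blast
  obtain i0 where i0: "i0 \<in> S" "0 < spec_norm (choice_jac a i0 \<theta>opt ** Z)"
    by (rule choice_jac_nonzero[OF fin outside ortho Z])
  define M0 where "M0 = spec_norm (choice_jac a i0 \<theta>opt ** Z)"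
  have M0: "0 < M0" using i0 by (simp add: M0_def)

  \<comment> \<open>The last two radii force \<open>LG \<delta> \<le> m / 2\<close> and \<open>Lp \<delta> \<le> M\<close>; adding \<open>1\<close> to the constants
    avoids a division by zero.\<close>
  define \<epsilon> where "\<epsilon> = Min {\<epsilon>1, \<epsilon>2, m0 / (2 * (CG + 1)), M0 / (Cp + 1)}"
  have \<epsilon>: "0 < \<epsilon>"
    using \<epsilon>1 \<epsilon>2 m0 M0 CG Cp by (simp add: \<epsilon>_def)
  have \<epsilon>_le: "\<epsilon> \<le> \<epsilon>1" "\<epsilon> \<le> \<epsilon>2" "\<epsilon> \<le> m0 / (2 * (CG + 1))" "\<epsilon> \<le> M0 / (Cp + 1)"
    by (simp_all add: \<epsilon>_def)
  define W where "W = active_face A b Istar \<inter> ball \<theta>opt \<epsilon>"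
  have "openin (top_of_set (active_face A b Istar)) W"
    unfolding W_def by (rule openin_open_Int) simp
  then have W: "nhd_within (active_face A b Istar) \<theta>opt W"
    unfolding nhd_within_def using \<epsilon> face by (auto simp: W_def)

  show ?thesis
  proof (intro exI[of _ W] conjI W allI impI, elim conjE)
    fix U
    assume nhd: "nhd_within (active_face A b Istar) \<theta>opt U" and "convex U" and "U \<subseteq> W"
      and diam: "\<forall>t\<in>T. \<theta> t \<in> U \<longrightarrow> attr_diam a S * norm (d t) \<le> 1"
    define m where "m = m_const G Z U"
    define M where "M = Mpi_const a S Z U"
    define K where "K = LG_const G Z U"
    define K' where "K' = Lpi_const a S Z U"
    define C where "C = K' / (2 * m) + 2 * M * K / m\<^sup>2"
    define \<nu>sq where "\<nu>sq t = d t \<bullet> (G (\<theta> t) *v d t)" for t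
    define q where "q t = newton_prob a (\<theta> t) (d t)" for t
    define H where "H = loss a y S \<theta>opt + pen * real CARD('n)"
    define LB where "LB t = lower_bound a b pen S (\<theta> t) (d t) (\<mu> t)" for t

    have U_face: "U \<subseteq> active_face A b (active_set A b \<theta>opt)"
      using \<open>U \<subseteq> W\<close> by (auto simp: W_def Istar_def)
    have close: "norm (z - \<theta>opt) < \<epsilon>" if "z \<in> U" for z
      using that \<open>U \<subseteq> W\<close> by (auto simp: W_def dist_norm norm_minus_commute)
    obtain r where r: "0 < r"
      and near: "\<And>h. h \<in> face_tangent A (active_set A b \<theta>opt) \<Longrightarrow> norm h < r \<Longrightarrow> \<theta>opt + h \<in> U"
      using nhd_within_active_face[OF feas nhd[unfolded Istar_def]] by blast
    have opt_U: "\<theta>opt \<in> U"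
      using near[OF subspace_0[OF subspace_face_tangent]] r by simp
    \<comment> \<open>A second point of \<open>U\<close> exists because the identified space is nontrivial.\<close>
    obtain p1 where p1: "p1 \<in> U" "\<theta>opt \<noteq> p1"
    proof -
      have "0 \<in> ident_space a S A Istar"
        using span_zero[of "columns Z"] by (simp only: \<open>span (columns Z) = ident_space a S A Istar\<close>)
      with \<open>ident_space a S A Istar \<noteq> {0}\<close> obtain v where v: "v \<in> ident_space a S A Istar" "v \<noteq> 0"
        by auto
      define h where "h = (r / (2 * norm v)) *\<^sub>R v"
      have "h \<in> face_tangent A (active_set A b \<theta>opt)"
        unfolding h_def using v(1)
        by (intro subspace_scale[OF subspace_face_tangent]) (simp add: ident_space_def Istar_def)
      moreover have "norm h < r"
        using r v(2) by (simp add: h_def)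
      moreover have "h \<noteq> 0"
        using r v(2) by (simp add: h_def)
      ultimately show ?thesis
        using near by (intro that[of "\<theta>opt + h"]) auto
    qed
    note LGU = LG[OF opt_U p1, folded K_def] and LpU = Lp[OF opt_U p1, folded K'_def]

    have m0_le: "m0 \<le> lambda_min (transpose Z ** G z ** Z)" if "z \<in> U" for z
      using close[OF that] \<epsilon>_le(2) by (intro eig) simp
    have m_ge: "m0 \<le> m"
      unfolding m_def m_const_def using opt_U m0_le by (intro cINF_greatest) auto
    then have m_pos: "0 < m" using m0 by simp
    have m_le: "m \<le> lambda_min (transpose Z ** G z ** Z)" if "z \<in> U" for z
      unfolding m_def m_const_def by (rule cINF_lower[OF bdd_belowI2[OF m0_le] that])
    have M_ge: "spec_norm (choice_jac a i z ** Z) \<le> M" if "i \<in> S" "z \<in> U" for i z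
      unfolding M_def using fin that by (rule spec_norm_choice_jac_le_Mpi_const)
    have M_pos: "M0 \<le> M"
      unfolding M0_def by (rule M_ge[OF i0(1) opt_U])
    have small: "K * norm (z - \<theta>opt) \<le> m / 2" "K' * norm (z - \<theta>opt) \<le> M" if "z \<in> U" for z
    proof -
      have "K * norm (z - \<theta>opt) \<le> (CG + 1) * (m0 / (2 * (CG + 1)))"
        using LGU CG close[OF that] \<epsilon>_le(3) by (intro mult_mono) auto
      also have "\<dots> = m0 / 2" using CG by (simp add: field_simps)
      finally show "K * norm (z - \<theta>opt) \<le> m / 2" using m_ge by simp
      have "K' * norm (z - \<theta>opt) \<le> (Cp + 1) * (M0 / (Cp + 1))"
        using LpU Cp close[OF that] \<epsilon>_le(4) by (intro mult_mono) auto
      also have "\<dots> = M0" using Cp by simp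
      finally show "K' * norm (z - \<theta>opt) \<le> M" using M_pos by simp
    qed

    \<comment> \<open>Convergence goes through the fourth power of the distance to the optimizer.\<close>
    define \<eta> where "\<eta> t = (K' / 2 + M * (K / (2 * m))) * (norm (\<theta> t - \<theta>opt))\<^sup>2" for t
    define B where "B = real (card S) * (K' / 2 + M * (K / (2 * m)))\<^sup>2 / pi_min a S \<theta>opt"
    define kl where "kl t = (\<Sum>i\<in>S. kl_div (q t i) (choice_prob a i \<theta>opt))" for t
    have step: "norm (q t i - choice_prob a i \<theta>opt) \<le> C * \<nu>sq t"
      "norm (q t i - choice_prob a i \<theta>opt) \<le> \<eta> t"
      if t: "t \<in> T" "\<theta> t \<in> U" and i: "i \<in> S" for t i
    proof -
      have "dist (\<theta> t) \<theta>opt < \<epsilon>1"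
        using close[OF t(2)] \<epsilon>_le(1) by (simp add: dist_norm)
      then have d: "d t \<in> face_tangent A (active_set A b \<theta>opt)"
        and supp: "\<And>r. r \<notin> active_set A b \<theta>opt \<Longrightarrow> \<mu> t $ r = 0"
        using stable[OF t(1)] t(2) U_face by (auto simp: Istar_def)
      have kkt: "newton_pair A b (loss a y S) (\<theta> t) (d t) (\<mu> t)"
        using \<open>\<forall>t\<in>T. \<theta> t \<in> polyhedron_of A b \<and> newton_pair A b L (\<theta> t) (d t) (\<mu> t)\<close> t(1)
        by (simp add: L_def)
      note error = newton_prob_error[OF min ortho Z U_face \<open>convex U\<close> opt_U t(2) r near kkt d supp i m_pos
          m_le[OF t(2), unfolded G_def L_def], where LG = K and M = M and Lp = K']
      show "norm (q t i - choice_prob a i \<theta>opt) \<le> C * \<nu>sq t"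
        unfolding q_def C_def \<nu>sq_def G_def L_def
        by (rule error(1)) (use LGU LpU M_pos M0 M_ge[OF i t(2)] small[OF t(2)] i in \<open>auto simp: G_def L_def\<close>)
      show "norm (q t i - choice_prob a i \<theta>opt) \<le> \<eta> t"
        unfolding q_def \<eta>_def
        by (rule error(2)) (use LGU LpU M_pos M0 M_ge[OF i t(2)] small[OF t(2)] i in \<open>auto simp: G_def L_def\<close>)
    qed
    have q_nonneg: "0 \<le> q t i $ j" if "t \<in> T" "\<theta> t \<in> U" "i \<in> S" for t i j
      unfolding q_def using diam that fin by (intro newton_prob_nonneg) auto
    have q_sum: "(\<Sum>j\<in>UNIV. q t i $ j) = 1" for t i
      unfolding q_def by (rule sum_newton_prob)
    have gap: "H - LB t = kl t" if t: "t \<in> T" "\<theta> t \<in> U" for t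
    proof -
      have "dist (\<theta> t) \<theta>opt < \<epsilon>1"
        using close[OF t(2)] \<epsilon>_le(1) by (simp add: dist_norm)
      then have supp: "\<And>r. r \<notin> active_set A b \<theta>opt \<Longrightarrow> \<mu> t $ r = 0"
        using stable[OF t(1)] t(2) U_face by (auto simp: Istar_def)
      have kkt: "newton_pair A b (loss a y S) (\<theta> t) (d t) (\<mu> t)"
        using \<open>\<forall>t\<in>T. \<theta> t \<in> polyhedron_of A b \<and> newton_pair A b L (\<theta> t) (d t) (\<mu> t)\<close> t(1)
        by (simp add: L_def)
      show ?thesis
        using newton_pair_gap_eq_kl_div[where ?\<theta>0.0 = \<theta>opt, OF kkt supp q_nonneg[OF t, unfolded q_def]]
        by (simp add: H_def LB_def lower_bound_def kl_def q_def)
    qed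
    have kl_nonneg: "0 \<le> kl t" if t: "t \<in> T" "\<theta> t \<in> U" for t
      unfolding kl_def using q_nonneg[OF t]
      by (intro sum_nonneg kl_div_nonneg) (auto simp: choice_prob_pos sum_choice_prob q_sum)
    have kl_le: "kl t \<le> real (card S) * C\<^sup>2 / pi_min a S \<theta>opt * (\<nu>sq t)\<^sup>2"
      "kl t \<le> B * norm (\<theta> t - \<theta>opt) ^ 4" if t: "t \<in> T" "\<theta> t \<in> U" for t
    proof -
      show "kl t \<le> real (card S) * C\<^sup>2 / pi_min a S \<theta>opt * (\<nu>sq t)\<^sup>2"
        using sum_kl_div_le[OF fin ne, of "q t" a \<theta>opt, OF q_nonneg[OF t] q_sum step(1)[OF t]]
        by (simp add: kl_def power_mult_distrib)
      show "kl t \<le> B * norm (\<theta> t - \<theta>opt) ^ 4"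
        using sum_kl_div_le[OF fin ne, of "q t" a \<theta>opt, OF q_nonneg[OF t] q_sum step(2)[OF t]]
        by (simp add: kl_def \<eta>_def B_def power_mult_distrib)
    qed

    let ?F = "inf (filtercomap \<theta> (nhds \<theta>opt)) (principal {t \<in> T. \<theta> t \<in> U})"
    have "(\<theta> \<longlongrightarrow> \<theta>opt) ?F"
      by (rule tendsto_mono[OF inf_le1 filterlim_filtercomap])
    then have "((\<lambda>t. H - B * norm (\<theta> t - \<theta>opt) ^ 4) \<longlongrightarrow> H - B * norm (\<theta>opt - \<theta>opt) ^ 4) ?F"
      by (intro tendsto_intros)
    then have lower: "((\<lambda>t. H - B * norm (\<theta> t - \<theta>opt) ^ 4) \<longlongrightarrow> H) ?F"
      by simp
    have ev: "\<forall>\<^sub>F t in ?F. t \<in> T \<and> \<theta> t \<in> U"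
      by (auto simp: eventually_inf_principal)
    have LB_lim: "(LB \<longlongrightarrow> H) ?F"
    proof (rule tendsto_sandwich[OF _ _ lower tendsto_const])
      show "\<forall>\<^sub>F t in ?F. H - B * norm (\<theta> t - \<theta>opt) ^ 4 \<le> LB t"
        using ev by eventually_elim (use gap kl_le(2) in fastforce)
      show "\<forall>\<^sub>F t in ?F. LB t \<le> H"
        using ev by eventually_elim (use gap kl_nonneg in fastforce)
    qed
    have leaf: "leaf_cost a y (polyhedron_of A b) pen Nmin S = ereal H"
      unfolding H_def by (rule leaf_cost_eq[OF min \<open>card S \<ge> Nmin\<close>])
    show "let m = m_const G Z U;
           C = Lpi_const a S Z U / (2 * m) + 2 * Mpi_const a S Z U * LG_const G Z U / m\<^sup>2;
           \<nu>sq = (\<lambda>t. d t \<bullet> (G (\<theta> t) *v d t));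
           q = (\<lambda>t. newton_prob a (\<theta> t) (d t));
           H = leaf_cost a y (polyhedron_of A b) pen Nmin S;
           LB = (\<lambda>t. lower_bound a b pen S (\<theta> t) (d t) (\<mu> t))
       in m > 0 \<and>
          (\<forall>t\<in>T. \<theta> t \<in> U \<longrightarrow>
             (MAX i\<in>S. norm (q t i - choice_prob a i \<theta>opt)) \<le> C * \<nu>sq t \<and>
             0 \<le> H - ereal (LB t) \<and>
             H - ereal (LB t) = ereal (\<Sum>i\<in>S. kl_div (q t i) (choice_prob a i \<theta>opt)) \<and>
             (\<Sum>i\<in>S. kl_div (q t i) (choice_prob a i \<theta>opt))
               \<le> real (card S) * C\<^sup>2 / pi_min a S \<theta>opt * (\<nu>sq t)\<^sup>2) \<and>
          ((\<lambda>t. ereal (LB t)) \<longlongrightarrow> H) ?F"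
      unfolding Let_def leaf
      unfolding m_def[symmetric] K_def[symmetric] K'_def[symmetric] M_def[symmetric]
      unfolding C_def[symmetric] \<nu>sq_def[symmetric] q_def[symmetric] LB_def[symmetric] kl_def[symmetric]
    proof (intro conjI ballI impI)
      show "0 < m" by (rule m_pos)
      show "((\<lambda>t. ereal (LB t)) \<longlongrightarrow> ereal H) ?F"
        using LB_lim by (rule tendsto_ereal)
      fix t assume t: "t \<in> T" "\<theta> t \<in> U"
      show "(MAX i\<in>S. norm (q t i - choice_prob a i \<theta>opt)) \<le> C * \<nu>sq t"
        using fin ne step(1)[OF t] by (intro Max.boundedI) auto
      show "0 \<le> ereal H - ereal (LB t)"
        using gap[OF t] kl_nonneg[OF t] by simp
      show "ereal H - ereal (LB t) = ereal (kl t)"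
        using gap[OF t] by simp
      show "kl t \<le> real (card S) * C\<^sup>2 / pi_min a S \<theta>opt * (\<nu>sq t)\<^sup>2"
        by (rule kl_le(1)[OF t])
    qed
  qed
qed

end
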